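(* Let $f:M\to S^n$ be any immersion of an oriented manifold, with geodesic Gauss map $\gamma:UM^\perp\to\mathcal Q$. Then the mean curvature vector field $H_\gamma$ of $\gamma$ is a Hamiltonian variation, i.e. the $1$-form $\sigma_{H_\gamma}=\lambda_{\mathcal Q}(H_\gamma,d\gamma(\cdot))$ on $UM^\perp$ is exact.
   Context: $S^n\subset\mathbb{R}^{n+1}$ is the round unit sphere with metric $g$ of curvature $1$, $\pi:US^n\to S^n$ its unit tangent bundle, $UM^\perp$ the unit normal bundle of $f$. The spherical Gauss map $\mu:UM^\perp\to US^n$ sends each unit normal vector to itself as a unit tangent vector of $S^n$. $\mathcal Q=US^n/S^1$ is the quotient by geodesic flow, the manifold of oriented geodesics of $S^n$, identified with $\mathrm{Gr}(2,n+1)=SO(n+1)/(SO(n-1)\times SO(2))$ (oriented $2$-planes in $\mathbb{R}^{n+1}$), with quotient map $\pi_{\mathcal Q}$. $US^n=SO(n+1)/SO(n-1)$ and $\mathcal Q$ carry the normal homogeneous metrics $h$, $h_{\mathcal Q}$ induced by $\langle\eta,\zeta\rangle=-\tfrac12\operatorname{tr}(\eta\zeta)$ on $\mathfrak{so}(n+1)$; $h$ is the restriction of the Sasaki metric and $\pi_{\mathcal Q}$ is a Riemannian submersion. With $\theta(Z)=g(d\pi(Z),v)$ for $Z\in T_vUS^n$ the canonical contact form, $\lambda_{\mathcal Q}$ is the symplectic form on $\mathcal Q$ with $\pi_{\mathcal Q}^*\lambda_{\mathcal Q}=-d\theta$; it is the Kähler form of a Hermitian symmetric (Kähler–Einstein)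 structure on $(\mathcal Q,h_{\mathcal Q})$. The geodesic Gauss map $\gamma=\pi_{\mathcal Q}\circ\mu$ is a Lagrangian immersion, and $UM^\perp$ has the metric $\gamma^*h_{\mathcal Q}=\mu^*h$. $H_\gamma$ is the (unnormalized) trace of the second fundamental form of $\gamma$. *)

theory Defs
  imports "HOL-Analysis.Analysis"
begin

section \<open>Smooth manifolds given by local parametrisations\<close>

text \<open>Intended for open \<open>S\<close> only, where it is the usual \<open>C\<^sup>k\<close>: all directional derivatives
  up to order \<open>k\<close> exist as Frechet derivatives and are continuous.\<close>

fun Ck_on :: "nat \<Rightarrow> 'a::real_normed_vector set \<Rightarrow> ('a \<Rightarrow> 'b::real_normed_vector) \<Rightarrow> bool" where
  "Ck_on 0 S f \<longleftrightarrow> continuous_on S f"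
| "Ck_on (Suc k) S f \<longleftrightarrow>
     (\<forall>x\<in>S. f differentiable (at x)) \<and> (\<forall>w. Ck_on k S (\<lambda>x. frechet_derivative f (at x) w))"

definition smooth_on :: "'a::real_normed_vector set \<Rightarrow> ('a \<Rightarrow> 'b::real_normed_vector) \<Rightarrow> bool" where
  "smooth_on S f \<longleftrightarrow> (\<forall>k. Ck_on k S f)"

text \<open>A local parametrisation of \<open>S\<close> is an inverse chart: a homeomorphism \<open>\<kappa>\<close> from an open set
  \<open>D\<close> of some \<open>\<real>\<^sup>k\<close> onto an open subset of \<open>S\<close>.\<close>

type_synonym ('k, 'a) param = "(real ^ 'k) set \<times> (real ^ 'k \<Rightarrow> 'a)"

definition local_param :: "'a::topological_space set \<Rightarrow> ('k::finite, 'a) param \<Rightarrow> bool" where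
  "local_param S = (\<lambda>(D, \<kappa>). open D \<and> openin (top_of_set S) (\<kappa> ` D) \<and>
     (\<exists>g. homeomorphism D (\<kappa> ` D) \<kappa> g))"

text \<open>The manifold is the whole type \<open>'p\<close>; the Hausdorff and countability axioms are
  imposed through its type class.\<close>

definition oriented_atlas ::
    "('m::finite, 'p::{t2_space, second_countable_topology}) param set \<Rightarrow> bool" where
  "oriented_atlas A \<longleftrightarrow>
     (\<forall>c\<in>A. local_param UNIV c) \<and>
     (\<Union>(D, \<kappa>)\<in>A. \<kappa> ` D) = UNIV \<and>
     (\<forall>(D, \<kappa>)\<in>A. \<forall>(D', \<kappa>')\<in>A.
        smooth_on {u\<in>D. \<kappa> u \<in> \<kappa>' ` D'} (\<lambda>u. inv_into D' \<kappa>' (\<kappa> u)) \<and>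
        (\<forall>u\<in>D. \<kappa> u \<in> \<kappa>' ` D' \<longrightarrow>
           det (matrix (frechet_derivative (\<lambda>u. inv_into D' \<kappa>' (\<kappa> u)) (at u))) > 0))"

text \<open>A 1-form on a manifold is presented by its pullbacks: \<open>\<sigma> \<kappa> u w\<close> is the value at the point
  \<open>\<kappa> u\<close> on the tangent vector \<open>d\<kappa> w\<close>. It is exact if it is the differential
  of one globally defined smooth function \<open>\<Theta>\<close>.\<close>

definition exact_one_form ::
    "('d::finite, 'a) param set \<Rightarrow> ((real ^ 'd \<Rightarrow> 'a) \<Rightarrow> real ^ 'd \<Rightarrow> real ^ 'd \<Rightarrow> real) \<Rightarrow> bool" where
  "exact_one_form P \<sigma> \<longleftrightarrow>
     (\<exists>\<Theta> :: 'a \<Rightarrow> real. \<forall>(D, \<kappa>)\<in>P. smooth_on D (\<Theta> \<circ> \<kappa>) \<and>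
        (\<forall>u\<in>D. \<forall>w. frechet_derivative (\<Theta> \<circ> \<kappa>) (at u) w = \<sigma> \<kappa> u w))"


section \<open>Spherical immersions and their unit normal bundles\<close>

definition sphere_immersion ::
    "('m::finite, 'p::topological_space) param set \<Rightarrow> ('p \<Rightarrow> real ^ 'n) \<Rightarrow> bool" where
  "sphere_immersion A f \<longleftrightarrow>
     (\<forall>p. f p \<in> sphere 0 1) \<and>
     (\<forall>(D, \<kappa>)\<in>A. smooth_on D (f \<circ> \<kappa>) \<and> (\<forall>u\<in>D. inj (frechet_derivative (f \<circ> \<kappa>) (at u))))"

definition tangent_image ::
    "('m::finite, 'p) param set \<Rightarrow> ('p \<Rightarrow> real ^ 'n) \<Rightarrow> 'p \<Rightarrow> (real ^ 'n) set" where
  "tangent_image A f p =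
     {frechet_derivative (f \<circ> \<kappa>) (at u) w | D \<kappa> u w. (D, \<kappa>) \<in> A \<and> u \<in> D \<and> \<kappa> u = p}"

definition unit_normal_bundle ::
    "('m::finite, 'p) param set \<Rightarrow> ('p \<Rightarrow> real ^ 'n) \<Rightarrow> ('p \<times> (real ^ 'n)) set" where
  "unit_normal_bundle A f =
     {(p, v). norm v = 1 \<and> v \<bullet> f p = 0 \<and> (\<forall>t\<in>tangent_image A f p. v \<bullet> t = 0)}"

text \<open>The local parametrisations of \<open>UM\<^sup>\<bottom>\<close> as an embedded submanifold of \<open>M \<times> \<real>\<^bsup>n+1\<^esup>\<close>:
  read in a chart of \<open>M\<close>, they are smooth and immersive. Here \<open>CARD('n) = n + 1\<close>, and
  \<open>CARD('d)\<close> has to be \<open>n - 1\<close>, the dimension of \<open>UM\<^sup>\<bottom>\<close>.\<close>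

definition unit_normal_params ::
    "('m::finite, 'p::topological_space) param set \<Rightarrow> ('p \<Rightarrow> real ^ 'n) \<Rightarrow>
     ('d::finite, 'p \<times> (real ^ 'n)) param set" where
  "unit_normal_params A f =
     {(D, \<kappa>). local_param (unit_normal_bundle A f) (D, \<kappa>) \<and>
        (\<forall>(D', \<kappa>')\<in>A. let \<rho> = (\<lambda>u. (inv_into D' \<kappa>' (fst (\<kappa> u)), snd (\<kappa> u))) in
           smooth_on {u\<in>D. fst (\<kappa> u) \<in> \<kappa>' ` D'} \<rho> \<and>
           (\<forall>u\<in>D. fst (\<kappa> u) \<in> \<kappa>' ` D' \<longrightarrow> inj (frechet_derivative \<rho> (at u))))}"


section \<open>The unit tangent bundle of the sphere\<close>

text \<open>A unit tangent vector \<open>v\<close> at \<open>x\<close> is the pair \<open>(x, v)\<close>.\<close>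

definition US :: "((real ^ 'n) \<times> (real ^ 'n)) set" where
  "US = {(x, v). norm x = 1 \<and> norm v = 1 \<and> x \<bullet> v = 0}"

definition TUS :: "(real ^ 'n) \<times> (real ^ 'n) \<Rightarrow> ((real ^ 'n) \<times> (real ^ 'n)) set" where
  "TUS = (\<lambda>(x, v). {(a, b). a \<bullet> x = 0 \<and> b \<bullet> v = 0 \<and> a \<bullet> v + x \<bullet> b = 0})"

text \<open>The contact form, extended by the same formula to all of \<open>\<real>\<^bsup>n+1\<^esup> \<times> \<real>\<^bsup>n+1\<^esup>\<close>; since exterior
  derivatives commute with restriction, \<open>d\<theta>\<close> may be computed there, with constant vector
  fields (whose bracket vanishes).\<close>

definition contact_form :: "(real ^ 'n) \<times> (real ^ 'n) \<Rightarrow> (real ^ 'n) \<times> (real ^ 'n) \<Rightarrow> real" where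
  "contact_form p Z = fst Z \<bullet> snd p"

definition ext_deriv ::
    "('a::real_normed_vector \<Rightarrow> 'a \<Rightarrow> real) \<Rightarrow> 'a \<Rightarrow> 'a \<Rightarrow> 'a \<Rightarrow> real" where
  "ext_deriv \<alpha> p Z W =
     frechet_derivative (\<lambda>p. \<alpha> p W) (at p) Z - frechet_derivative (\<lambda>p. \<alpha> p Z) (at p) W"

definition geodesic_flow :: "real \<Rightarrow> (real ^ 'n) \<times> (real ^ 'n) \<Rightarrow> (real ^ 'n) \<times> (real ^ 'n)" where
  "geodesic_flow t = (\<lambda>(x, v). (cos t *\<^sub>R x + sin t *\<^sub>R v, - sin t *\<^sub>R x + cos t *\<^sub>R v))"


section \<open>The space of oriented geodesics\<close>

definition so :: "(real ^ 'n ^ 'n) set" where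
  "so = {\<eta>. transpose \<eta> = - \<eta>}"

definition ip_so :: "real ^ 'n ^ 'n \<Rightarrow> real ^ 'n ^ 'n \<Rightarrow> real" where
  "ip_so \<eta> \<zeta> = - (1/2) * trace (\<eta> ** \<zeta>)"

definition bracket :: "real ^ 'n ^ 'n \<Rightarrow> real ^ 'n ^ 'n \<Rightarrow> real ^ 'n ^ 'n" where
  "bracket \<eta> \<zeta> = \<eta> ** \<zeta> - \<zeta> ** \<eta>"

text \<open>The oriented plane with oriented orthonormal basis \<open>x, v\<close> is represented by
  \<open>v x\<^sup>T - x v\<^sup>T\<close>, the generator of the rotations \<open>x \<mapsto> v \<mapsto> -x\<close>. This realises
  \<open>SO(n+1) / (SO(n-1) \<times> SO(2))\<close> as an adjoint orbit; by the lemma \<open>piQ_eq_iff\<close> below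
  the fibres of \<open>piQ\<close> on \<open>US\<close> are the orbits of the geodesic flow.\<close>

definition piQ :: "(real ^ 'n) \<times> (real ^ 'n) \<Rightarrow> real ^ 'n ^ 'n" where
  "piQ = (\<lambda>(x, v). \<chi> i j. v $ i * x $ j - x $ i * v $ j)"

definition Q :: "(real ^ 'n ^ 'n) set" where
  "Q = piQ ` US"

abbreviation dpiQ :: "(real ^ 'n) \<times> (real ^ 'n) \<Rightarrow> (real ^ 'n) \<times> (real ^ 'n) \<Rightarrow> real ^ 'n ^ 'n" where
  "dpiQ p \<equiv> frechet_derivative piQ (at p)"

text \<open>Tangent spaces of the orbit, and the normal homogeneous metric: the isotropy representation
  identifies \<open>T\<^sub>qQ\<close> with the orthogonal complement of the isotropy algebra at \<open>q\<close>.\<close>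

definition TQ :: "real ^ 'n ^ 'n \<Rightarrow> (real ^ 'n ^ 'n) set" where
  "TQ q = (\<lambda>\<eta>. bracket \<eta> q) ` so"

definition isotropy :: "real ^ 'n ^ 'n \<Rightarrow> (real ^ 'n ^ 'n) set" where
  "isotropy q = {\<zeta>\<in>so. bracket \<zeta> q = 0}"

definition iso_compl :: "real ^ 'n ^ 'n \<Rightarrow> (real ^ 'n ^ 'n) set" where
  "iso_compl q = {\<eta>\<in>so. \<forall>\<zeta>\<in>isotropy q. ip_so \<eta> \<zeta> = 0}"

definition so_lift :: "real ^ 'n ^ 'n \<Rightarrow> real ^ 'n ^ 'n \<Rightarrow> real ^ 'n ^ 'n" where
  "so_lift q X = (THE \<eta>. \<eta> \<in> iso_compl q \<and> bracket \<eta> q = X)"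

definition hQ :: "real ^ 'n ^ 'n \<Rightarrow> real ^ 'n ^ 'n \<Rightarrow> real ^ 'n ^ 'n \<Rightarrow> real" where
  "hQ q X Y = ip_so (so_lift q X) (so_lift q Y)"

text \<open>The symplectic form determined by \<open>\<pi>\<^sub>Q\<^sup>*\<lambda>\<^sub>Q = -d\<theta>\<close>; see \<open>lambdaQ_pullback\<close> below.\<close>

definition lambdaQ :: "real ^ 'n ^ 'n \<Rightarrow> real ^ 'n ^ 'n \<Rightarrow> real ^ 'n ^ 'n \<Rightarrow> real" where
  "lambdaQ q X Y = (THE r. \<exists>p\<in>US. \<exists>Z\<in>TUS p. \<exists>W\<in>TUS p.
     piQ p = q \<and> dpiQ p Z = X \<and> dpiQ p W = Y \<and> r = - ext_deriv contact_form p Z W)"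


section \<open>Mean curvature of maps into \<open>Q\<close>\<close>

text \<open>By \<open>hQ_eq_ip_so\<close> below, \<open>hQ\<close> is the metric which \<open>Q\<close> inherits from the Euclidean
  space \<open>(so, ip_so)\<close>, so its Levi-Civita connection is the tangential part of the
  derivative in \<open>so\<close>.\<close>

definition tan_proj :: "real ^ 'n ^ 'n \<Rightarrow> real ^ 'n ^ 'n \<Rightarrow> real ^ 'n ^ 'n" where
  "tan_proj q Y = (THE X. X \<in> TQ q \<and> (\<forall>Z\<in>TQ q. ip_so (Y - X) Z = 0))"

text \<open>Covariant derivative in direction \<open>w\<close> of a vector field \<open>V\<close> along the map \<open>F\<close>.\<close>

definition cov_deriv ::
    "(real ^ 'd \<Rightarrow> real ^ 'n ^ 'n) \<Rightarrow> (real ^ 'd \<Rightarrow> real ^ 'n ^ 'n) \<Rightarrow> real ^ 'd \<Rightarrow> real ^ 'd \<Rightarrow>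
     real ^ 'n ^ 'n" where
  "cov_deriv F V u w = tan_proj (F u) (frechet_derivative V (at u) w)"

text \<open>The second fundamental form of an immersion \<open>F\<close>: the \<open>hQ\<close>-normal part of the covariant
  derivative of the coordinate field \<open>dF(w')\<close>.\<close>

definition second_ff ::
    "(real ^ 'd \<Rightarrow> real ^ 'n ^ 'n) \<Rightarrow> real ^ 'd \<Rightarrow> real ^ 'd \<Rightarrow> real ^ 'd \<Rightarrow> real ^ 'n ^ 'n" where
  "second_ff F u w w' = (THE N. N \<in> TQ (F u) \<and>
     (\<forall>y. hQ (F u) N (frechet_derivative F (at u) y) = 0) \<and>
     (\<exists>y. cov_deriv F (\<lambda>u. frechet_derivative F (at u) w') u w
            = N + frechet_derivative F (at u) y))"

definition orthonormal_basis :: "('a::real_vector \<Rightarrow> 'a \<Rightarrow> real) \<Rightarrow> 'a set \<Rightarrow> bool" where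
  "orthonormal_basis g E \<longleftrightarrow> finite E \<and> span E = UNIV \<and>
     (\<forall>e\<in>E. \<forall>e'\<in>E. g e e' = (if e = e' then 1 else 0))"

definition metric_trace ::
    "('a::real_vector \<Rightarrow> 'a \<Rightarrow> real) \<Rightarrow> ('a \<Rightarrow> 'a \<Rightarrow> 'b::real_vector) \<Rightarrow> 'b" where
  "metric_trace g B = (\<Sum>e\<in>(SOME E. orthonormal_basis g E). B e e)"

definition induced_metric ::
    "(real ^ 'd \<Rightarrow> real ^ 'n ^ 'n) \<Rightarrow> real ^ 'd \<Rightarrow> real ^ 'd \<Rightarrow> real ^ 'd \<Rightarrow> real" where
  "induced_metric F u w w' =
     hQ (F u) (frechet_derivative F (at u) w) (frechet_derivative F (at u) w')"

definition mean_curvature :: "(real ^ 'd \<Rightarrow> real ^ 'n ^ 'n) \<Rightarrow> real ^ 'd \<Rightarrow> real ^ 'n ^ 'n" where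
  "mean_curvature F u = metric_trace (induced_metric F u) (second_ff F u)"


section \<open>The geodesic Gauss map\<close>

definition spherical_gauss :: "('p \<Rightarrow> real ^ 'n) \<Rightarrow> 'p \<times> (real ^ 'n) \<Rightarrow> (real ^ 'n) \<times> (real ^ 'n)" where
  "spherical_gauss f = (\<lambda>(p, v). (f p, v))"

definition geodesic_gauss :: "('p \<Rightarrow> real ^ 'n) \<Rightarrow> 'p \<times> (real ^ 'n) \<Rightarrow> real ^ 'n ^ 'n" where
  "geodesic_gauss f = piQ \<circ> spherical_gauss f"

text \<open>For a vector field \<open>X\<close> along \<open>\<gamma>\<close>, with value \<open>X \<kappa> u\<close> at the point \<open>\<kappa> u\<close>, the 1-form
  \<open>\<sigma>\<^sub>X = \<lambda>\<^sub>Q(X, d\<gamma>(\<cdot>))\<close>.\<close>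

definition variation_form ::
    "('a \<Rightarrow> real ^ 'n ^ 'n) \<Rightarrow> ((real ^ 'd \<Rightarrow> 'a) \<Rightarrow> real ^ 'd \<Rightarrow> real ^ 'n ^ 'n) \<Rightarrow>
     (real ^ 'd \<Rightarrow> 'a) \<Rightarrow> real ^ 'd \<Rightarrow> real ^ 'd \<Rightarrow> real" where
  "variation_form \<gamma> X \<kappa> u w =
     lambdaQ (\<gamma> (\<kappa> u)) (X \<kappa> u) (frechet_derivative (\<gamma> \<circ> \<kappa>) (at u) w)"

definition hamiltonian_variation ::
    "('d::finite, 'a) param set \<Rightarrow> ('a \<Rightarrow> real ^ 'n ^ 'n) \<Rightarrow>
     ((real ^ 'd \<Rightarrow> 'a) \<Rightarrow> real ^ 'd \<Rightarrow> real ^ 'n ^ 'n) \<Rightarrow> bool" where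
  "hamiltonian_variation P \<gamma> X \<longleftrightarrow> exact_one_form P (variation_form \<gamma> X)"

definition mean_curvature_field ::
    "('a \<Rightarrow> real ^ 'n ^ 'n) \<Rightarrow> (real ^ 'd \<Rightarrow> 'a) \<Rightarrow> real ^ 'd \<Rightarrow> real ^ 'n ^ 'n" where
  "mean_curvature_field \<gamma> \<kappa> u = mean_curvature (\<gamma> \<circ> \<kappa>) u"


section \<open>Consistency of the definitions\<close>

lemma matrix_vector_bracket: "bracket \<eta> \<zeta> *v y = \<eta> *v (\<zeta> *v y) - \<zeta> *v (\<eta> *v y)"
  by (simp add: bracket_def matrix_vector_mult_diff_rdistrib matrix_vector_mul_assoc)

lemma piQ_mult: "piQ (x, v) *v y = (x \<bullet> y) *\<^sub>R v - (v \<bullet> y) *\<^sub>R x"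
  by (simp add: vec_eq_iff piQ_def matrix_vector_mult_def inner_vec_def algebra_simps
      sum_subtractf sum_distrib_left)

lemma piQ_in_so: "piQ p \<in> so"
  by (cases p) (simp add: so_def vec_eq_iff piQ_def transpose_def)

lemma so_inner: "\<zeta> \<in> so \<Longrightarrow> (\<zeta> *v y) \<bullet> z = - (y \<bullet> (\<zeta> *v z))"
proof -
  assume "\<zeta> \<in> so"
  then have "transpose \<zeta> = - \<zeta>" by (simp add: so_def)
  moreover have "(- \<zeta>) *v z = - (\<zeta> *v z)"
    by (metis add.left_inverse add.right_neutral diff_0 matrix_vector_mult_0 matrix_vector_mult_diff_rdistrib)
  moreover have "(\<zeta> *v y) \<bullet> z = y \<bullet> (transpose \<zeta> *v z)"
    by (metis dot_lmul_matrix inner_commute vector_transpose_matrix transpose_transpose)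
  ultimately show ?thesis by simp
qed

lemma bracket_piQ:
  assumes "\<zeta> \<in> so"
  shows "bracket \<zeta> (piQ (x, v)) = piQ (\<zeta> *v x, v) + piQ (x, \<zeta> *v v)"
proof -
  have "bracket \<zeta> (piQ (x, v)) *v y = (piQ (\<zeta> *v x, v) + piQ (x, \<zeta> *v v)) *v y" for y
    using so_inner[OF assms, of x y] so_inner[OF assms, of v y]
    by (simp add: matrix_vector_bracket piQ_mult matrix_vector_mult_add_rdistrib
        matrix_vector_mult_diff_distrib matrix_vector_mult_scaleR algebra_simps)
  then show ?thesis by (simp add: matrix_eq)
qed

lemma ip_so_piQ: "\<eta> \<in> so \<Longrightarrow> ip_so \<eta> (piQ (u, w)) = (\<eta> *v u) \<bullet> w"
proof -
  assume "\<eta> \<in> so"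
  have "trace (\<eta> ** piQ (u, w)) = u \<bullet> (\<eta> *v w) - w \<bullet> (\<eta> *v u)"
    by (simp add: trace_def matrix_matrix_mult_def piQ_def inner_vec_def matrix_vector_mult_def
        sum_distrib_left sum_subtractf algebra_simps)
  with so_inner[OF \<open>\<eta> \<in> so\<close>, of u w] show ?thesis
    by (simp add: ip_so_def inner_commute)
qed

lemma ip_so_sym: "ip_so \<eta> \<zeta> = ip_so \<zeta> \<eta>"
  unfolding ip_so_def by (subst trace_mul_sym) (rule refl)

lemma so_entry: "\<eta> \<in> so \<Longrightarrow> \<eta> $ i $ j = - (\<eta> $ j $ i)"
proof -
  assume "\<eta> \<in> so"
  then have "transpose \<eta> $ j $ i = (- \<eta>) $ j $ i" by (simp add: so_def)
  then show ?thesis by (simp add: transpose_def)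
qed

lemma ip_so_eq_half_inner: "\<zeta> \<in> so \<Longrightarrow> ip_so \<eta> \<zeta> = (1/2) * (\<eta> \<bullet> \<zeta>)"
proof -
  assume "\<zeta> \<in> so"
  have "trace (\<eta> ** \<zeta>) = (\<Sum>i\<in>UNIV. \<Sum>j\<in>UNIV. \<eta> $ i $ j * \<zeta> $ j $ i)"
    by (simp add: trace_def matrix_matrix_mult_def)
  also have "\<dots> = (\<Sum>i\<in>UNIV. \<Sum>j\<in>UNIV. - (\<eta> $ i $ j * \<zeta> $ i $ j))"
  proof (intro sum.cong refl)
    fix i j
    show "\<eta> $ i $ j * \<zeta> $ j $ i = - (\<eta> $ i $ j * \<zeta> $ i $ j)"
      using so_entry[OF \<open>\<zeta> \<in> so\<close>, of j i] by simp
  qed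
  finally show ?thesis by (simp add: ip_so_def inner_vec_def sum_negf)
qed

lemma soI:
  assumes "\<And>i j. A $ i $ j = - (A $ j $ i)"
  shows "A \<in> so"
proof -
  have "transpose A $ i $ j = (- A) $ i $ j" for i j
    using assms[of j i] by (simp add: transpose_def)
  then show ?thesis unfolding so_def by (simp only: vec_eq_iff mem_Collect_eq) blast
qed

lemma subspace_so: "subspace so"
  unfolding subspace_def
proof (intro conjI ballI allI)
  show "(0 :: real ^ 'n ^ 'n) \<in> so" by (rule soI) simp
next
  fix A B :: "real ^ 'n ^ 'n" assume "A \<in> so" "B \<in> so"
  show "A + B \<in> so"
  proof (rule soI)
    show "(A + B) $ i $ j = - ((A + B) $ j $ i)" for i j
      using so_entry[OF \<open>A \<in> so\<close>, of i j] so_entry[OF \<open>B \<in> so\<close>, of i j] by simp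
  qed
next
  fix A :: "real ^ 'n ^ 'n" and c :: real assume "A \<in> so"
  show "c *\<^sub>R A \<in> so"
  proof (rule soI)
    show "(c *\<^sub>R A) $ i $ j = - ((c *\<^sub>R A) $ j $ i)" for i j
      using so_entry[OF \<open>A \<in> so\<close>, of i j] by simp
  qed
qed

lemma bracket_in_so: "\<eta> \<in> so \<Longrightarrow> \<zeta> \<in> so \<Longrightarrow> bracket \<eta> \<zeta> \<in> so"
proof -
  assume a: "\<eta> \<in> so" "\<zeta> \<in> so"
  have 1: "(\<eta> ** \<zeta>) $ j $ i = (\<zeta> ** \<eta>) $ i $ j" for i j
  proof -
    have "\<eta> $ j $ k * \<zeta> $ k $ i = \<zeta> $ i $ k * \<eta> $ k $ j" for k
      using so_entry[OF a(1), of j k] so_entry[OF a(2), of k i] by simp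
    then show ?thesis by (simp add: matrix_matrix_mult_def)
  qed
  show ?thesis
  proof (rule soI)
    show "bracket \<eta> \<zeta> $ i $ j = - (bracket \<eta> \<zeta> $ j $ i)" for i j
      by (simp add: bracket_def 1[of i j] 1[of j i])
  qed
qed

lemma bracket_antisym: "bracket \<eta> \<zeta> = - bracket \<zeta> \<eta>"
  by (simp add: bracket_def)

lemma bracket_zero [simp]: "bracket 0 \<zeta> = 0" "bracket \<eta> 0 = 0"
  by (simp_all add: bracket_def)

lemma bracket_diff:
  "bracket (\<eta> - \<eta>') \<zeta> = bracket \<eta> \<zeta> - bracket \<eta>' \<zeta>"
  "bracket \<zeta> (\<eta> - \<eta>') = bracket \<zeta> \<eta> - bracket \<zeta> \<eta>'"
  by (simp_all add: matrix_eq matrix_vector_bracket matrix_vector_mult_diff_rdistrib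
      matrix_vector_mult_diff_distrib)

lemma bracket_add:
  "bracket \<zeta> (\<eta> + \<eta>') = bracket \<zeta> \<eta> + bracket \<zeta> \<eta>'"
  using bracket_diff(2)[of \<zeta> "\<eta> + \<eta>'" \<eta>'] by simp

lemma bracket_uminus:
  "bracket (- \<eta>) \<zeta> = - bracket \<eta> \<zeta>" "bracket \<zeta> (- \<eta>) = - bracket \<zeta> \<eta>"
  using bracket_diff(1)[of 0 \<eta> \<zeta>] bracket_diff(2)[of \<zeta> 0 \<eta>] by simp_all

lemma ip_so_bracket: "ip_so (bracket A B) C = ip_so A (bracket B C)"
proof -
  have "trace (B ** A ** C) = trace (A ** (C ** B))"
    by (metis matrix_mul_assoc trace_mul_sym)
  moreover have "(A ** B - B ** A) ** C = A ** B ** C - B ** A ** C"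
    by (simp add: matrix_eq matrix_vector_mult_diff_rdistrib flip: matrix_vector_mul_assoc)
  moreover have "A ** (B ** C - C ** B) = A ** (B ** C) - A ** (C ** B)"
    by (simp add: matrix_eq matrix_vector_mult_diff_rdistrib matrix_vector_mult_diff_distrib
        flip: matrix_vector_mul_assoc)
  ultimately show ?thesis
    by (simp add: ip_so_def bracket_def trace_sub matrix_mul_assoc)
qed

lemma ip_so_definite: "\<eta> \<in> so \<Longrightarrow> ip_so \<eta> \<eta> = 0 \<Longrightarrow> \<eta> = 0"
  by (simp add: ip_so_eq_half_inner)

lemma piQ_alg:
  "piQ (a + b, c) = piQ (a, c) + piQ (b, c)" "piQ (c, a + b) = piQ (c, a) + piQ (c, b)"
  "piQ (a - b, c) = piQ (a, c) - piQ (b, c)" "piQ (c, a - b) = piQ (c, a) - piQ (c, b)"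
  "piQ (- a, c) = - piQ (a, c)" "piQ (c, - a) = - piQ (c, a)"
  "piQ (r *\<^sub>R a, c) = r *\<^sub>R piQ (a, c)" "piQ (c, r *\<^sub>R a) = r *\<^sub>R piQ (c, a)"
  by (simp_all add: piQ_def vec_eq_iff algebra_simps)

lemma piQ_self [simp]: "piQ (a, a) = 0"
  by (simp add: piQ_def vec_eq_iff)

lemma piQ_swap: "piQ (a, b) = - piQ (b, a)"
  by (simp add: piQ_def vec_eq_iff)

lemma US_D: "(x, v) \<in> US \<Longrightarrow> x \<bullet> x = 1 \<and> v \<bullet> v = 1 \<and> x \<bullet> v = 0 \<and> v \<bullet> x = 0"
  by (auto simp: US_def inner_commute simp flip: norm_eq_1)

lemma TQ_bracket_bracket:
  assumes "q \<in> Q" and "X \<in> TQ q"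
  shows "bracket q (bracket q X) = - X"
proof -
  obtain x v \<xi> where q: "(x, v) \<in> US" "q = piQ (x, v)" and \<xi>: "\<xi> \<in> so" "X = bracket \<xi> q"
    using assms by (auto simp: Q_def TQ_def)
  note i = US_D[OF q(1)]
  have qso: "q \<in> so" by (simp add: q piQ_in_so)
  define c where "c = (\<xi> *v x) \<bullet> v"
  define a where "a = \<xi> *v x - c *\<^sub>R v"
  define b where "b = \<xi> *v v + c *\<^sub>R x"
  have s: "(\<xi> *v x) \<bullet> x = 0" "(\<xi> *v v) \<bullet> v = 0" "(\<xi> *v v) \<bullet> x = - c"
    using so_inner[OF \<xi>(1), of x x] so_inner[OF \<xi>(1), of v v] so_inner[OF \<xi>(1), of v x]
    by (simp_all add: inner_commute c_def)
  have ab: "x \<bullet> a = 0" "v \<bullet> a = 0" "x \<bullet> b = 0" "v \<bullet> b = 0"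
    using s i by (simp_all add: a_def b_def algebra_simps inner_commute)
      (simp add: c_def inner_commute)
  have X: "X = piQ (a, v) + piQ (x, b)"
    unfolding \<xi>(2) q(2) bracket_piQ[OF \<xi>(1)] a_def b_def
    by (simp add: piQ_alg)
  have qq: "q *v x = v" "q *v v = - x" "q *v a = 0" "q *v b = 0"
    using i ab by (simp_all add: q(2) piQ_mult)
  have B: "bracket q X = - piQ (a, x) + piQ (v, b)"
    by (simp add: X bracket_add bracket_piQ[OF qso] qq piQ_alg)
       (simp add: piQ_def vec_eq_iff)
  have "bracket q (bracket q X) = - piQ (a, v) - piQ (x, b)"
    unfolding B bracket_add bracket_uminus bracket_piQ[OF qso] qq
    by (simp add: piQ_alg) (simp add: piQ_def vec_eq_iff)
  then show ?thesis by (simp add: X)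
qed

lemma Q_in_so: "q \<in> Q \<Longrightarrow> q \<in> so"
  by (auto simp: Q_def piQ_in_so)

lemma TQ_in_so: "q \<in> Q \<Longrightarrow> X \<in> TQ q \<Longrightarrow> X \<in> so"
  by (auto simp: TQ_def bracket_in_so Q_in_so)

lemma so_lift_unique:
  assumes "q \<in> Q" and "X \<in> TQ q"
  shows "\<exists>!\<eta>. \<eta> \<in> iso_compl q \<and> bracket \<eta> q = X" and "so_lift q X = bracket q X"
proof -
  have q: "q \<in> so" and X: "X \<in> so" using assms Q_in_so TQ_in_so by auto
  have "ip_so (bracket q X) \<zeta> = 0" if "\<zeta> \<in> isotropy q" for \<zeta>
  proof -
    have "bracket \<zeta> q = 0" using that by (simp add: isotropy_def)
    moreover have "ip_so (bracket q X) \<zeta> = ip_so (bracket \<zeta> q) X"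
      by (metis ip_so_bracket ip_so_sym)
    ultimately show ?thesis by (simp add: ip_so_def trace_def matrix_matrix_mult_def)
  qed
  then have 1: "bracket q X \<in> iso_compl q"
    by (simp add: iso_compl_def bracket_in_so q X)
  have 2: "bracket (bracket q X) q = X"
    using TQ_bracket_bracket[OF assms] bracket_antisym[of "bracket q X" q] by simp
  have 3: "\<eta> = \<eta>'" if h: "\<eta> \<in> iso_compl q" "bracket \<eta> q = X" "\<eta>' \<in> iso_compl q" "bracket \<eta>' q = X" for \<eta> \<eta>'
  proof -
    have d: "\<eta> - \<eta>' \<in> so" using h by (auto simp: iso_compl_def intro: subspace_diff[OF subspace_so])
    then have i: "\<eta> - \<eta>' \<in> isotropy q" using h by (simp add: isotropy_def bracket_diff)
    have "ip_so \<eta> (\<eta> - \<eta>') = 0" "ip_so \<eta>' (\<eta> - \<eta>') = 0"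
      using h i by (auto simp: iso_compl_def)
    then have "ip_so (\<eta> - \<eta>') (\<eta> - \<eta>') = 0"
      by (simp add: ip_so_eq_half_inner[OF d] inner_diff_left)
    from ip_so_definite[OF d this] show ?thesis by simp
  qed
  show "\<exists>!\<eta>. \<eta> \<in> iso_compl q \<and> bracket \<eta> q = X"
    using 1 2 3 by blast
  show "so_lift q X = bracket q X"
    unfolding so_lift_def using 1 2 3 by blast
qed

lemma hQ_eq_ip_so:
  assumes "q \<in> Q" "X \<in> TQ q" "Y \<in> TQ q"
  shows "hQ q X Y = ip_so X Y"
proof -
  have so: "q \<in> so" "X \<in> so" "Y \<in> so" using assms Q_in_so TQ_in_so by auto
  have "hQ q X Y = ip_so (bracket q X) (bracket q Y)"
    using assms by (simp add: hQ_def so_lift_unique(2))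
  also have "\<dots> = - ip_so (bracket X q) (bracket q Y)"
    by (simp add: bracket_antisym[of q X] ip_so_eq_half_inner[OF bracket_in_so[OF so(1,3)]])
  also have "\<dots> = - ip_so X (bracket q (bracket q Y))"
    by (simp add: ip_so_bracket)
  also have "\<dots> = ip_so X Y"
    using TQ_bracket_bracket[OF assms(1,3)] so(3)
    by (simp add: ip_so_eq_half_inner subspace_neg[OF subspace_so])
  finally show ?thesis .
qed

lemma bounded_bilinear_piQ: "bounded_bilinear (\<lambda>a b. piQ (a, b))"
  unfolding bilinear_conv_bounded_bilinear[symmetric] bilinear_def
  by (auto intro!: linearI simp: piQ_alg)

lemma dpiQ_eq: "dpiQ (x, v) (a, b) = piQ (a, v) + piQ (x, b)"
proof -
  have "((\<lambda>p. piQ (fst p, snd p)) has_derivative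
      (\<lambda>h. piQ (fst (x, v), snd h) + piQ (fst h, snd (x, v)))) (at (x, v))"
    by (rule bounded_bilinear.FDERIV[OF bounded_bilinear_piQ]) (auto intro!: derivative_eq_intros)
  from frechet_derivative_at[OF this, symmetric] show ?thesis
    by simp
qed

lemma ext_deriv_contact:
  fixes p :: "(real ^ 'n) \<times> (real ^ 'n)"
  shows "ext_deriv contact_form p (a, b) (a', b') = b \<bullet> a' - b' \<bullet> a"
proof -
  have "frechet_derivative (\<lambda>p. contact_form p W) (at p) Z = snd Z \<bullet> fst W"
    for W Z :: "(real ^ 'n) \<times> (real ^ 'n)"
  proof -
    have "((\<lambda>p. contact_form p W) has_derivative (\<lambda>Z. fst W \<bullet> snd Z)) (at p)"
      unfolding contact_form_def by (auto intro!: derivative_eq_intros)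
    from frechet_derivative_at[OF this, symmetric] show ?thesis
      by (simp add: inner_commute)
  qed
  then show ?thesis by (simp add: ext_deriv_def)
qed

lemma minus_dtheta_eq:
  fixes p :: "(real ^ 'n) \<times> (real ^ 'n)"
  assumes "p \<in> US" "Z \<in> TUS p" "W \<in> TUS p"
  shows "- ext_deriv contact_form p Z W = ip_so (bracket (piQ p) (dpiQ p Z)) (dpiQ p W)"
proof -
  obtain x v a b a' b' where p: "p = (x, v)" "Z = (a, b)" "W = (a', b')"
    by (metis surj_pair)
  note i = US_D[OF assms(1)[unfolded p]]
  let ?q = "piQ (x, v)"
  have t: "a \<bullet> x = 0" "x \<bullet> a = 0" "b \<bullet> v = 0" "v \<bullet> b = 0" "x \<bullet> b = - (a \<bullet> v)" "b \<bullet> x = - (a \<bullet> v)" "v \<bullet> a = a \<bullet> v"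
    "a' \<bullet> x = 0" "x \<bullet> a' = 0" "b' \<bullet> v = 0" "v \<bullet> b' = 0" "x \<bullet> b' = - (a' \<bullet> v)" "b' \<bullet> x = - (a' \<bullet> v)" "v \<bullet> a' = a' \<bullet> v"
    using assms(2,3) by (auto simp: p TUS_def inner_commute)
  have q: "?q *v x = v" "?q *v v = - x" "?q *v a = - (a \<bullet> v) *\<^sub>R x" "?q *v b = - (a \<bullet> v) *\<^sub>R v"
    using i t by (simp_all add: piQ_mult)
  have B: "bracket ?q (dpiQ p Z) = piQ (v, b) - piQ (a, x) - (2 * (a \<bullet> v)) *\<^sub>R ?q"
    unfolding p dpiQ_eq bracket_add bracket_piQ[OF piQ_in_so] q
    by (simp add: piQ_alg) (simp add: piQ_def vec_eq_iff algebra_simps)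
  have so: "piQ (v, b) - piQ (a, x) - (2 * (a \<bullet> v)) *\<^sub>R ?q \<in> so"
    by (intro subspace_diff[OF subspace_so] subspace_scale[OF subspace_so] piQ_in_so)
  have add: "ip_so Y (U + V) = ip_so Y U + ip_so Y V" if "U \<in> so" "V \<in> so" for Y U V :: "real ^ 'n ^ 'n"
    using that by (simp add: ip_so_eq_half_inner inner_add_right subspace_add[OF subspace_so])
  have "ip_so (bracket ?q (dpiQ p Z)) (dpiQ p W) = a \<bullet> b' - b \<bullet> a'"
    unfolding B unfolding p dpiQ_eq add[OF piQ_in_so piQ_in_so] ip_so_piQ[OF so]
    using i t
    by (simp add: piQ_mult matrix_vector_mult_diff_rdistrib inner_diff_left inner_add_left
        flip: scaleR_matrix_vector_assoc)
  then show ?thesis by (simp add: p ext_deriv_contact inner_commute)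
qed

lemma lambdaQ_pullback:
  assumes "p \<in> US" "Z \<in> TUS p" "W \<in> TUS p"
  shows "lambdaQ (piQ p) (dpiQ p Z) (dpiQ p W) = - ext_deriv contact_form p Z W"
  unfolding lambdaQ_def
proof (rule the_equality)
  show "\<exists>p'\<in>US. \<exists>Z'\<in>TUS p'. \<exists>W'\<in>TUS p'. piQ p' = piQ p \<and> dpiQ p' Z' = dpiQ p Z \<and>
      dpiQ p' W' = dpiQ p W \<and> - ext_deriv contact_form p Z W = - ext_deriv contact_form p' Z' W'"
    using assms by blast
next
  fix r
  assume "\<exists>p'\<in>US. \<exists>Z'\<in>TUS p'. \<exists>W'\<in>TUS p'. piQ p' = piQ p \<and> dpiQ p' Z' = dpiQ p Z \<and>
      dpiQ p' W' = dpiQ p W \<and> r = - ext_deriv contact_form p' Z' W'"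
  then show "r = - ext_deriv contact_form p Z W"
    using minus_dtheta_eq assms by metis
qed

lemma dpiQ_TUS:
  assumes "p \<in> US"
  shows "dpiQ p ` TUS p = TQ (piQ p)"
proof -
  obtain x v where p: "p = (x, v)" by (metis surj_pair)
  note i = US_D[OF assms[unfolded p]]
  have q: "piQ p \<in> Q" "piQ p \<in> so" using assms by (auto simp: Q_def piQ_in_so)
  show ?thesis
  proof (intro equalityI subsetI)
    fix X assume "X \<in> TQ (piQ p)"
    then obtain \<xi> where \<xi>: "\<xi> \<in> so" "X = bracket \<xi> (piQ p)" by (auto simp: TQ_def)
    have "X = dpiQ p (\<xi> *v x, \<xi> *v v)"
      using \<xi> by (simp add: p dpiQ_eq bracket_piQ)
    moreover have "(\<xi> *v x, \<xi> *v v) \<in> TUS p"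
      using so_inner[OF \<xi>(1), of x x] so_inner[OF \<xi>(1), of v v] so_inner[OF \<xi>(1), of x v]
      by (simp add: p TUS_def inner_commute)
    ultimately show "X \<in> dpiQ p ` TUS p" by blast
  next
    fix X assume "X \<in> dpiQ p ` TUS p"
    then obtain a b where Z: "(a, b) \<in> TUS p" "X = dpiQ p (a, b)" by auto
    have t: "a \<bullet> x = 0" "x \<bullet> a = 0" "b \<bullet> v = 0" "v \<bullet> b = 0" "x \<bullet> b = - (a \<bullet> v)" "v \<bullet> a = a \<bullet> v"
      using Z(1) by (auto simp: p TUS_def inner_commute)
    let ?q = "piQ (x, v)"
    have qq: "?q *v x = v" "?q *v v = - x" "?q *v a = - (a \<bullet> v) *\<^sub>R x" "?q *v b = - (a \<bullet> v) *\<^sub>R v"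
      using i t by (simp_all add: piQ_mult)
    have X: "X = piQ (a, v) + piQ (x, b)" using Z by (simp add: p dpiQ_eq)
    have B: "bracket ?q X = piQ (v, b) - piQ (a, x) - piQ ((2 * (a \<bullet> v)) *\<^sub>R x, v)"
      unfolding X bracket_add bracket_piQ[OF piQ_in_so] qq
      by (simp add: piQ_alg) (simp add: piQ_def vec_eq_iff algebra_simps)
    have "bracket ?q (bracket ?q X) = - X"
      unfolding B unfolding bracket_diff bracket_piQ[OF piQ_in_so] qq X matrix_vector_mult_scaleR
      by (simp add: piQ_alg)
    then have "X = bracket (bracket ?q X) ?q"
      using bracket_antisym[of "bracket ?q X" ?q] by simp
    moreover have "bracket ?q X \<in> so"
      unfolding X by (intro bracket_in_so piQ_in_so subspace_add[OF subspace_so])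
    ultimately show "X \<in> TQ (piQ p)"
      unfolding p TQ_def by blast
  qed
qed

text \<open>On horizontal vectors (those with \<open>\<theta> = 0\<close>) the Sasaki metric of \<open>US\<close> is the Euclidean
  one, so this says that \<open>piQ\<close> is a Riemannian submersion.\<close>

lemma hQ_dpiQ_horizontal:
  assumes "p \<in> US" "Z \<in> TUS p" "W \<in> TUS p" "contact_form p Z = 0" "contact_form p W = 0"
  shows "hQ (piQ p) (dpiQ p Z) (dpiQ p W) = fst Z \<bullet> fst W + snd Z \<bullet> snd W"
proof -
  obtain x v a b a' b' where p: "p = (x, v)" "Z = (a, b)" "W = (a', b')"
    by (metis surj_pair)
  note i = US_D[OF assms(1)[unfolded p]]
  have t: "a \<bullet> x = 0" "b \<bullet> v = 0" "a \<bullet> v = 0" "b \<bullet> x = 0" "a' \<bullet> x = 0" "b' \<bullet> v = 0" "a' \<bullet> v = 0" "b' \<bullet> x = 0"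
    using assms(2-5) by (auto simp: p TUS_def contact_form_def inner_commute)
  have so: "piQ (a, v) + piQ (x, b) \<in> so"
    by (intro subspace_add[OF subspace_so] piQ_in_so)
  have "hQ (piQ p) (dpiQ p Z) (dpiQ p W) = ip_so (dpiQ p Z) (dpiQ p W)"
    using assms dpiQ_TUS[OF assms(1)] by (intro hQ_eq_ip_so) (auto simp: Q_def)
  also have "\<dots> = ip_so (piQ (a, v) + piQ (x, b)) (piQ (a', v)) + ip_so (piQ (a, v) + piQ (x, b)) (piQ (x, b'))"
    by (simp add: p dpiQ_eq ip_so_eq_half_inner piQ_in_so inner_add_right
        subspace_add[OF subspace_so])
  also have "\<dots> = a \<bullet> a' + b \<bullet> b'"
    using i t by (simp add: ip_so_piQ[OF so] matrix_vector_mult_add_rdistrib piQ_mult inner_commute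
        inner_diff_left inner_add_left inner_diff_right inner_add_right)
  finally show ?thesis by (simp add: p)
qed

lemma piQ_eq_iff:
  assumes "p \<in> US" "p' \<in> US"
  shows "piQ p = piQ p' \<longleftrightarrow> (\<exists>t. p' = geodesic_flow t p)"
proof -
  obtain x v x' v' where p: "p = (x, v)" "p' = (x', v')" by (metis surj_pair)
  note i = US_D[OF assms(1)[unfolded p]] and i' = US_D[OF assms(2)[unfolded p]]
  show ?thesis
  proof
    assume eq: "piQ p = piQ p'"
    have v': "v' = (x \<bullet> x') *\<^sub>R v - (v \<bullet> x') *\<^sub>R x"
      using arg_cong[OF eq, of "\<lambda>q. q *v x'"] i' by (simp add: p piQ_mult)
    have x': "x' = - ((x \<bullet> v') *\<^sub>R v - (v \<bullet> v') *\<^sub>R x)"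
      using arg_cong[OF eq, of "\<lambda>q. q *v v'"] i' by (simp add: p piQ_mult)
    define c s where "c = x \<bullet> x'" and "s = v \<bullet> x'"
    have vv: "v' = c *\<^sub>R v - s *\<^sub>R x" using v' by (simp add: c_def s_def)
    have "x \<bullet> v' = - s" "v \<bullet> v' = c" using i by (simp_all add: vv inner_diff_right)
    then have xx: "x' = c *\<^sub>R x + s *\<^sub>R v" using x' by simp
    have "c\<^sup>2 + s\<^sup>2 = 1"
      using i i' unfolding xx by (simp add: inner_add_left inner_add_right power2_eq_square)
    then obtain t where "c = cos t" "s = sin t" using sincos_total_2pi by metis
    then show "\<exists>t. p' = geodesic_flow t p"
      by (intro exI[of _ t]) (simp add: p geodesic_flow_def xx vv)
  next
    assume "\<exists>t. p' = geodesic_flow t p"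
    then obtain t where t: "x' = cos t *\<^sub>R x + sin t *\<^sub>R v" "v' = - sin t *\<^sub>R x + cos t *\<^sub>R v"
      by (auto simp: p geodesic_flow_def)
    have "piQ p' = ((cos t)\<^sup>2 + (sin t)\<^sup>2) *\<^sub>R piQ p"
      unfolding p t scaleR_add_left power2_eq_square
      by (simp add: piQ_alg piQ_swap[of v x])
    then show "piQ p = piQ p'" by simp
  qed
qed

lemma tan_proj_props:
  assumes "q \<in> Q" "Y \<in> so"
  shows "tan_proj q Y \<in> TQ q" and "Z \<in> TQ q \<Longrightarrow> ip_so (tan_proj q Y) Z = ip_so Y Z"
proof -
  have q: "q \<in> so" using assms Q_in_so by auto
  define X where "X = bracket (bracket q Y) q"
  have X: "X \<in> TQ q" using assms q by (simp add: X_def TQ_def bracket_in_so)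
  have ip: "ip_so X Z = ip_so Y Z" if "Z \<in> TQ q" for Z
  proof -
    have Z: "Z \<in> so" using TQ_in_so assms that by auto
    have "ip_so X Z = ip_so (bracket q Y) (bracket q Z)"
      by (simp add: X_def ip_so_bracket)
    also have "\<dots> = - ip_so (bracket Y q) (bracket q Z)"
      by (simp add: bracket_antisym[of q Y] ip_so_eq_half_inner[OF bracket_in_so[OF q Z]])
    also have "\<dots> = ip_so Y Z"
      using TQ_bracket_bracket[OF assms(1) that] Z
      by (simp add: ip_so_bracket ip_so_eq_half_inner subspace_neg[OF subspace_so])
    finally show ?thesis .
  qed
  have sub: "subspace (TQ q)"
  proof -
    have "linear (\<lambda>\<eta>. bracket \<eta> q)"
      by (auto intro!: linearI simp: matrix_eq matrix_vector_bracket matrix_vector_mult_add_rdistrib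
          matrix_vector_right_distrib scaleR_matrix_vector_assoc[symmetric] matrix_vector_mult_scaleR
          matrix_vector_mult_diff_rdistrib scaleR_diff_right)
    then show ?thesis unfolding TQ_def by (rule linear_subspace_image[OF _ subspace_so])
  qed
  have "tan_proj q Y = X"
    unfolding tan_proj_def
  proof (rule the_equality)
    show "X \<in> TQ q \<and> (\<forall>Z\<in>TQ q. ip_so (Y - X) Z = 0)"
      using X ip TQ_in_so[OF assms(1)] by (simp add: ip_so_eq_half_inner inner_diff_left)
  next
    fix X' assume h: "X' \<in> TQ q \<and> (\<forall>Z\<in>TQ q. ip_so (Y - X') Z = 0)"
    have d: "X' - X \<in> TQ q" using h X sub by (simp add: subspace_diff)
    then have dso: "X' - X \<in> so" using TQ_in_so assms by auto
    have "ip_so (Y - X') (X' - X) = 0" "ip_so X (X' - X) = ip_so Y (X' - X)"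
      using h d ip by auto
    then have "ip_so (X' - X) (X' - X) = 0"
      by (simp add: ip_so_eq_half_inner[OF dso] inner_diff_left)
    from ip_so_definite[OF dso this] show "X' = X" by simp
  qed
  then show "tan_proj q Y \<in> TQ q" "Z \<in> TQ q \<Longrightarrow> ip_so (tan_proj q Y) Z = ip_so Y Z"
    using X ip by auto
qed

text \<open>Compatibility of \<open>cov_deriv\<close> with \<open>hQ\<close>. (It is torsion-free because
  second derivatives commute.)\<close>

lemma cov_deriv_metric:
  fixes F V W :: "real ^ 'd::finite \<Rightarrow> real ^ 'n ^ 'n"
  assumes D: "open D" "u \<in> D" and F: "\<And>y. y \<in> D \<Longrightarrow> F y \<in> Q"
    and V: "V differentiable (at u)" "\<And>y. y \<in> D \<Longrightarrow> V y \<in> TQ (F y)"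
    and W: "W differentiable (at u)" "\<And>y. y \<in> D \<Longrightarrow> W y \<in> TQ (F y)"
  shows "frechet_derivative (\<lambda>y. hQ (F y) (V y) (W y)) (at u) w =
           hQ (F u) (cov_deriv F V u w) (W u) + hQ (F u) (V u) (cov_deriv F W u w)"
proof -
  let ?V = "frechet_derivative V (at u)" and ?W = "frechet_derivative W (at u)"
  have V': "(V has_derivative ?V) (at u)" and W': "(W has_derivative ?W) (at u)"
    using V W frechet_derivative_works by blast+
  have so: "G' w \<in> so"
    if G: "(G has_derivative G') (at u)" "\<And>y. y \<in> D \<Longrightarrow> G y \<in> so"
    for G G' :: "real ^ 'd \<Rightarrow> real ^ 'n ^ 'n"
  proof -
    have "G' w $ i $ j = - (G' w $ j $ i)" for i j
    proof -
      have 1: "((\<lambda>y. G y $ i $ j) has_derivative (\<lambda>h. G' h $ i $ j)) (at u)" for i j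
        by (intro bounded_linear.has_derivative[OF bounded_linear_vec_nth] G(1))
      have "((\<lambda>y. - (G y $ j $ i)) has_derivative (\<lambda>h. - (G' h $ j $ i))) (at u)"
        by (intro has_derivative_minus 1)
      then have "((\<lambda>y. G y $ i $ j) has_derivative (\<lambda>h. - (G' h $ j $ i))) (at u)"
        by (rule has_derivative_transform_within_open[OF _ D])
           (simp add: so_entry[OF G(2), of _ i j])
      from has_derivative_unique[OF 1 this] show ?thesis by (auto simp: fun_eq_iff)
    qed
    then show ?thesis by (rule soI)
  qed
  have Vso: "y \<in> D \<Longrightarrow> V y \<in> so" and Wso: "y \<in> D \<Longrightarrow> W y \<in> so" for y
    using V(2) W(2) F TQ_in_so by blast+
  have V'so: "?V w \<in> so" and W'so: "?W w \<in> so"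
    using so[OF V' Vso] so[OF W' Wso] by auto
  have "((\<lambda>y. (1/2) * (V y \<bullet> W y)) has_derivative
      (\<lambda>h. (1/2) * (V u \<bullet> ?W h + ?V h \<bullet> W u))) (at u)"
    by (intro has_derivative_mult_right has_derivative_inner V' W')
  then have "((\<lambda>y. hQ (F y) (V y) (W y)) has_derivative
      (\<lambda>h. (1/2) * (V u \<bullet> ?W h + ?V h \<bullet> W u))) (at u)"
    by (rule has_derivative_transform_within_open[OF _ D])
       (simp add: hQ_eq_ip_so F V(2) W(2) ip_so_eq_half_inner Wso)
  from frechet_derivative_at[OF this, symmetric]
  have "frechet_derivative (\<lambda>y. hQ (F y) (V y) (W y)) (at u) w
          = (1/2) * (V u \<bullet> ?W w + ?V w \<bullet> W u)"
    by simp
  also have "\<dots> = ip_so (?V w) (W u) + ip_so (?W w) (V u)"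
    by (simp add: ip_so_eq_half_inner Vso Wso D inner_commute)
  also have "\<dots> = ip_so (cov_deriv F V u w) (W u) + ip_so (cov_deriv F W u w) (V u)"
    using tan_proj_props(2)[OF F V'so] tan_proj_props(2)[OF F W'so] V(2) W(2) D
    by (simp add: cov_deriv_def)
  also have "\<dots> = hQ (F u) (cov_deriv F V u w) (W u) + hQ (F u) (V u) (cov_deriv F W u w)"
    using tan_proj_props(1)[OF F V'so] tan_proj_props(1)[OF F W'so] V(2) W(2) D F
    by (simp add: cov_deriv_def hQ_eq_ip_so ip_so_sym)
  finally show ?thesis .
qed

end

theory Submission
  imports Defs
begin

text \<open>Lift \<open>\<gamma>\<close> to the Legendrian map \<open>u \<mapsto> (x, v)\<close>. The complex matrix of \<open>dx + i dv\<close> in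
  orthonormal frames has a determinant whose argument (the Lagrangian angle) is a primitive of
  \<open>\<sigma>\<^sub>H\<close> up to sign, but in general only modulo \<open>\<pi>\<close>. What makes it single-valued for a Gauss map is the
  shape operator: if \<open>G\<close> is the first and \<open>h\<close> the second fundamental form of \<open>f\<close> in the normal
  direction \<open>v\<close>, read in a chart of \<open>M\<close>, then \<open>\<sigma>\<^sub>H\<close> is the differential of
  \<open>\<Theta> = arg det (G + i h)\<close>, which is the sum of the arctangents of the principal curvatures.
  Symmetric matrices with positive definite real part form a convex set on which the determinant has
  no zero, hence has a continuous logarithm there; this is the branch of the argument. A change
  of chart acts by a real congruence, which does not change the argument.\<close>

section \<open>Calculus of \<open>C\<^sup>k\<close> maps\<close>

text \<open>Let a and b be the derivatives of the lift x, v along a tangent vector e of the normal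
  bundle. By the Weingarten equation, pairing a - i b with the coordinate tangent vectors of M gives
  G + i h applied to the real coordinates of a. In directions normal to f the part a vanishes. So
  the conjugate frame matrix is, up to real factors, block diagonal with blocks G + i h and -i times
  the identity, and arg det (G + i h) is minus the Lagrangian angle plus a constant, modulo \<pi>.
  That explains the choice of \<Theta>. The obstacle is that the mean curvature is traced over an
  arbitrary orthonormal basis at each point, which need not vary continuously, so a frame matrix
  cannot be differentiated. Identities are therefore differentiated with each basis vector e held
  constant, and only G + i h, which is smooth in the base point and the normal vector, is
  differentiated as a matrix.\<close>

lemma Ck_on_cong:
  assumes "open S" "\<And>x. x \<in> S \<Longrightarrow> f x = g x" "Ck_on k S f"
  shows "Ck_on k S g"
  using assms(2,3)
proof (induction k arbitrary: f g)
  case 0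
  then show ?case using continuous_on_cong by auto
next
  case (Suc k)
  have *: "(g has_derivative frechet_derivative f (at x)) (at x)" if "x \<in> S" for x
    using Suc.prems that assms(1) frechet_derivative_works
    by (auto intro!: has_derivative_transform_within_open[of f _ x UNIV S g])
  then have eq: "frechet_derivative f (at x) w = frechet_derivative g (at x) w" if "x \<in> S" for x w
    using that frechet_derivative_at by metis
  have "Ck_on k S (\<lambda>x. frechet_derivative f (at x) w)" for w
    using Suc.prems(2) by simp
  then have "Ck_on k S (\<lambda>x. frechet_derivative g (at x) w)" for w
    using Suc.IH[of "\<lambda>x. frechet_derivative f (at x) w" "\<lambda>x. frechet_derivative g (at x) w", OF eq] by blast
  then show ?case
    using * unfolding Ck_on.simps differentiable_def by blast
qed

lemma Ck_on_SucI:
  assumes "open S" "\<And>x. x \<in> S \<Longrightarrow> (f has_derivative f' x) (at x)"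
    and "\<And>w. Ck_on k S (\<lambda>x. f' x w)"
  shows "Ck_on (Suc k) S f"
proof -
  have "frechet_derivative f (at x) = f' x" if "x \<in> S" for x
    using assms(2)[OF that] frechet_derivative_at by metis
  then have "Ck_on k S (\<lambda>x. frechet_derivative f (at x) w)" for w
    by (intro Ck_on_cong[OF assms(1) _ assms(3)[of w]]) simp
  moreover have "f differentiable (at x)" if "x \<in> S" for x
    using assms(2)[OF that] by (rule differentiableI)
  ultimately show ?thesis by simp
qed

lemma Ck_on_SucD:
  assumes "Ck_on (Suc k) S f"
  shows "x \<in> S \<Longrightarrow> (f has_derivative frechet_derivative f (at x)) (at x)"
    and "Ck_on k S (\<lambda>x. frechet_derivative f (at x) w)"
  using assms frechet_derivative_works by auto

lemma Ck_on_local: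
  assumes "\<And>x. x \<in> S \<Longrightarrow> \<exists>U. open U \<and> x \<in> U \<and> Ck_on k U f"
  shows "Ck_on k S f"
  using assms
proof (induction k arbitrary: f)
  case 0
  then show ?case
    by (force intro!: continuous_at_imp_continuous_on simp: continuous_on_eq_continuous_at)
next
  case (Suc k)
  have "Ck_on k S (\<lambda>x. frechet_derivative f (at x) w)" for w
    by (rule Suc.IH) (use Suc.prems in fastforce)
  then show ?case using Suc.prems by fastforce
qed

lemma Ck_on_lower: "Ck_on (Suc k) S f \<Longrightarrow> Ck_on k S f"
proof (induction k arbitrary: f)
  case 0
  then show ?case
    by (auto intro!: continuous_at_imp_continuous_on differentiable_imp_continuous_within)
qed auto

lemma Ck_on_const: "Ck_on k S (\<lambda>x. c)"
  by (induction k arbitrary: c) auto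

lemma Ck_on_linear:
  assumes "bounded_linear L" "open S" "Ck_on k S f"
  shows "Ck_on k S (\<lambda>x. L (f x))"
  using assms(3)
proof (induction k arbitrary: f)
  case 0
  then show ?case using assms by (auto intro: bounded_linear.continuous_on)
next
  case (Suc k)
  show ?case
    by (rule Ck_on_SucI[OF assms(2) bounded_linear.has_derivative[OF assms(1)]])
      (use Ck_on_SucD[OF Suc.prems] Suc.IH in auto)
qed

lemma Ck_on_minus: "open S \<Longrightarrow> Ck_on k S f \<Longrightarrow> Ck_on k S (\<lambda>x. - f x)"
  by (rule Ck_on_linear[OF bounded_linear_minus[OF bounded_linear_ident]])

lemma Ck_on_add:
  assumes "open S" "Ck_on k S f" "Ck_on k S g"
  shows "Ck_on k S (\<lambda>x. f x + g x)"
  using assms(2,3)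
proof (induction k arbitrary: f g)
  case 0
  then show ?case by (auto intro: continuous_on_add)
next
  case (Suc k)
  show ?case
    by (rule Ck_on_SucI[OF assms(1) has_derivative_add])
      (use Ck_on_SucD[OF Suc.prems(1)] Ck_on_SucD[OF Suc.prems(2)] Suc.IH in auto)
qed

lemma Ck_on_sum:
  assumes "open S" "\<And>i. i \<in> I \<Longrightarrow> Ck_on k S (f i)"
  shows "Ck_on k S (\<lambda>x. \<Sum>i\<in>I. f i x)"
  using assms(2)
  by (induction I rule: infinite_finite_induct) (auto intro: Ck_on_const Ck_on_add assms(1))

lemma Ck_on_bilinear:
  assumes "bounded_bilinear B" "open S" "Ck_on k S f" "Ck_on k S g"
  shows "Ck_on k S (\<lambda>x. B (f x) (g x))"
  using assms(3,4)
proof (induction k arbitrary: f g)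
  case 0
  then show ?case by (auto intro: bounded_bilinear.continuous_on[OF assms(1)])
next
  case (Suc k)
  note f = Ck_on_SucD[OF Suc.prems(1)] Ck_on_lower[OF Suc.prems(1)]
  note g = Ck_on_SucD[OF Suc.prems(2)] Ck_on_lower[OF Suc.prems(2)]
  show ?case
    by (rule Ck_on_SucI[OF assms(2) bounded_bilinear.FDERIV[OF assms(1)]])
      (use f g Suc.IH in \<open>auto intro!: Ck_on_add assms(2)\<close>)
qed

lemma Ck_on_prod:
  fixes f :: "'i \<Rightarrow> 'a::real_normed_vector \<Rightarrow> 'b::real_normed_field"
  assumes "open S" "\<And>i. i \<in> I \<Longrightarrow> Ck_on k S (f i)"
  shows "Ck_on k S (\<lambda>x. \<Prod>i\<in>I. f i x)"
  using assms(2)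
  by (induction I rule: infinite_finite_induct)
    (auto intro: Ck_on_const Ck_on_bilinear[OF bounded_bilinear_mult] assms(1))

lemma Ck_on_inverse:
  fixes f :: "'a::real_normed_vector \<Rightarrow> 'b::real_normed_field"
  assumes "open S" "Ck_on k S f" "\<And>x. x \<in> S \<Longrightarrow> f x \<noteq> 0"
  shows "Ck_on k S (\<lambda>x. inverse (f x))"
  using assms(2)
proof (induction k)
  case 0
  then show ?case using assms(3) by (auto intro: continuous_on_inverse)
next
  case (Suc k)
  have *: "Ck_on k S (\<lambda>x. inverse (f x) * frechet_derivative f (at x) w * inverse (f x))" for w
    using Suc.IH[OF Ck_on_lower[OF Suc.prems]] Ck_on_SucD(2)[OF Suc.prems]
    by (intro Ck_on_bilinear[OF bounded_bilinear_mult assms(1)])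
  show ?case
  proof (rule Ck_on_SucI[OF assms(1)])
    show "((\<lambda>x. inverse (f x)) has_derivative
        (\<lambda>h. - (inverse (f x) * frechet_derivative f (at x) h * inverse (f x)))) (at x)" if "x \<in> S" for x
      using that by (intro Deriv.has_derivative_inverse assms(3) Ck_on_SucD(1)[OF Suc.prems])
  qed (intro Ck_on_minus[OF assms(1)] *)
qed

text \<open>\<open>Ck_on\<close> controls the derivative of \<open>f\<close> only along fixed
  vectors, while the chain rule applies it to a direction that varies with \<open>x\<close>.
  Expanding that direction in \<open>Basis\<close> resolves this, hence the Euclidean middle
  space.\<close>

lemma Ck_on_compose:
  fixes g :: "'a::real_normed_vector \<Rightarrow> 'b::euclidean_space"
  assumes "open S" "Ck_on k S g" "Ck_on k T f" "g ` S \<subseteq> T"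
  shows "Ck_on k S (\<lambda>x. f (g x))"
  using assms(2,3)
proof (induction k arbitrary: f)
  case 0
  then show ?case using assms(4) continuous_on_compose2[of T f S g] by simp
next
  case (Suc k)
  note f = Ck_on_SucD[OF Suc.prems(2)]
  note g = Ck_on_SucD[OF Suc.prems(1)] Ck_on_lower[OF Suc.prems(1)]
  have exp: "frechet_derivative f (at y) w = (\<Sum>b\<in>Basis. (w \<bullet> b) *\<^sub>R frechet_derivative f (at y) b)"
    if "y \<in> T" for y w
  proof -
    interpret linear "frechet_derivative f (at y)"
      using f(1)[OF that] has_derivative_linear by blast
    have "frechet_derivative f (at y) w = frechet_derivative f (at y) (\<Sum>b\<in>Basis. (w \<bullet> b) *\<^sub>R b)"
      by (simp only: euclidean_representation)
    then show ?thesis by (simp only: sum scale)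
  qed
  have 1: "Ck_on k S (\<lambda>x. frechet_derivative g (at x) w \<bullet> b)" for w b
    by (rule Ck_on_bilinear[OF bounded_bilinear_inner assms(1) g(2) Ck_on_const])
  have 2: "Ck_on k S (\<lambda>x. frechet_derivative f (at (g x)) b)" for b
    by (rule Suc.IH[OF g(3) f(2)])
  have *: "Ck_on k S (\<lambda>x. \<Sum>b\<in>Basis. (frechet_derivative g (at x) w \<bullet> b) *\<^sub>R frechet_derivative f (at (g x)) b)" for w
    by (rule Ck_on_sum[OF assms(1) Ck_on_bilinear[OF bounded_bilinear_scaleR assms(1) 1 2]])
  have **: "Ck_on k S (\<lambda>x. frechet_derivative f (at (g x)) (frechet_derivative g (at x) w))" for w
    by (rule Ck_on_cong[OF assms(1) _ *[of w]]) (use assms(4) in \<open>simp add: exp image_subset_iff\<close>)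
  show ?case
  proof (rule Ck_on_SucI[OF assms(1) _ **])
    show "((\<lambda>x. f (g x)) has_derivative
        (\<lambda>w. frechet_derivative f (at (g x)) (frechet_derivative g (at x) w))) (at x)" if "x \<in> S" for x
      using assms(4) that by (intro has_derivative_compose[OF g(1) f(1)]) auto
  qed
qed

text \<open>Only differentiability of \<open>f' w\<close> at the single point \<open>x\<close> is needed: the mean value theorem
  is applied to \<open>\<xi> \<mapsto> f (x + \<xi> w + t z) - f (x + \<xi> w)\<close>.\<close>

lemma second_difference_limit:
  fixes f :: "'a::real_normed_vector \<Rightarrow> real"
  assumes "open S" "x \<in> S" and df: "\<And>y. y \<in> S \<Longrightarrow> (f has_derivative f' y) (at y)"
    and dw: "((\<lambda>y. f' y w) has_derivative L) (at x)"
  shows "((\<lambda>t. (f (x + t *\<^sub>R w + t *\<^sub>R z) - f (x + t *\<^sub>R w) - f (x + t *\<^sub>R z) + f x) / t\<^sup>2) \<longlongrightarrow> L z) (at_right 0)"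
proof (rule tendstoI)
  fix e :: real assume e: "e > 0"
  define M where "M = norm w + norm z + 1"
  have M: "M > 0" "norm w \<le> M" "norm z + norm w \<le> M" by (auto simp: M_def add_pos_nonneg add.commute)
  \<comment> \<open>The mean value theorem leaves two errors of size at most d * t * M; after
    division by t they add up to at most 2 * d * M = e / 2.\<close>
  define d where "d = e / (4 * M)"
  have d: "d > 0" "2 * d * M < e" using e M by (auto simp: d_def field_simps)
  from dw[unfolded has_derivative_at_alt] d(1) obtain r where r: "r > 0"
    "\<And>y. norm (y - x) < r \<Longrightarrow> norm (f' y w - f' x w - L (y - x)) \<le> d * norm (y - x)" by blast
  have lin: "linear L" using dw has_derivative_linear by blast
  obtain s where s: "s > 0" "ball x s \<subseteq> S" using assms(1,2) openE by blast
  have in_ball_add: "norm y < s \<Longrightarrow> x + y \<in> ball x s" for y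
    by (simp add: dist_norm)
  define r' where "r' = min r s / M"
  have r': "r' > 0" "r' * M \<le> r" "r' * M \<le> s" using r s M by (auto simp: r'_def)
  have main: "dist ((f (x + t *\<^sub>R w + t *\<^sub>R z) - f (x + t *\<^sub>R w) - f (x + t *\<^sub>R z) + f x) / t\<^sup>2) (L z) < e"
    if t: "0 < t" "t < r'" for t
  proof -
    have tM: "t * M < r" "t * M < s" using t r' M by (smt (verit) mult_strict_right_mono)+
    have bd: "norm (\<xi> *\<^sub>R w) \<le> t * M" "norm (\<xi> *\<^sub>R w + t *\<^sub>R z) \<le> t * M" if "0 \<le> \<xi>" "\<xi> \<le> t" for \<xi>
    proof -
      have "norm (\<xi> *\<^sub>R w) \<le> t * norm w" using that by (simp add: mult_right_mono)
      moreover have "t * norm w \<le> t * M" "t * (norm z + norm w) \<le> t * M" using M t by (auto intro!: mult_left_mono)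
      moreover have "norm (\<xi> *\<^sub>R w + t *\<^sub>R z) \<le> norm (\<xi> *\<^sub>R w) + norm (t *\<^sub>R z)" by (rule norm_triangle_ineq)
      moreover have "norm (t *\<^sub>R z) = t * norm z" using t by simp
      ultimately show "norm (\<xi> *\<^sub>R w) \<le> t * M" "norm (\<xi> *\<^sub>R w + t *\<^sub>R z) \<le> t * M"
        by (auto simp: algebra_simps)
    qed
    have inS: "x + \<xi> *\<^sub>R w \<in> S" "x + \<xi> *\<^sub>R w + t *\<^sub>R z \<in> S" if "0 \<le> \<xi>" "\<xi> \<le> t" for \<xi>
      using bd[OF that] tM in_ball_add s(2) unfolding add.assoc by fastforce+
    define h where "h \<xi> = f (x + \<xi> *\<^sub>R w + t *\<^sub>R z) - f (x + \<xi> *\<^sub>R w)" for \<xi>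
    have dh: "(h has_derivative (\<lambda>k. k * (f' (x + \<xi> *\<^sub>R w + t *\<^sub>R z) w - f' (x + \<xi> *\<^sub>R w) w))) (at \<xi>)"
      if "0 \<le> \<xi>" "\<xi> \<le> t" for \<xi>
    proof -
      have 1: "((\<lambda>\<xi>. x + \<xi> *\<^sub>R w + t *\<^sub>R z) has_derivative (\<lambda>k. k *\<^sub>R w)) (at \<xi>)"
        "((\<lambda>\<xi>. x + \<xi> *\<^sub>R w) has_derivative (\<lambda>k. k *\<^sub>R w)) (at \<xi>)"
        by (auto intro!: derivative_eq_intros)
      have "(h has_derivative (\<lambda>k. f' (x + \<xi> *\<^sub>R w + t *\<^sub>R z) (k *\<^sub>R w) - f' (x + \<xi> *\<^sub>R w) (k *\<^sub>R w))) (at \<xi>)"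
        unfolding h_def
        by (intro has_derivative_diff has_derivative_compose[OF 1(1) df] has_derivative_compose[OF 1(2) df] inS that)
      moreover have "linear (f' y)" if "y \<in> S" for y using df[OF that] has_derivative_linear by blast
      ultimately show ?thesis using inS[OF that] by (simp add: linear_cmul right_diff_distrib)
    qed
    obtain \<xi> where \<xi>: "0 < \<xi>" "\<xi> < t"
      "h t - h 0 = (t - 0) * (f' (x + \<xi> *\<^sub>R w + t *\<^sub>R z) w - f' (x + \<xi> *\<^sub>R w) w)"
      using mvt[OF t(1), of h "\<lambda>\<xi> k. k * (f' (x + \<xi> *\<^sub>R w + t *\<^sub>R z) w - f' (x + \<xi> *\<^sub>R w) w)"]
        dh by (metis atLeastAtMost_iff continuous_on_eq_continuous_within has_derivative_at_withinI has_derivative_continuous less_imp_le)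
    define u where "u = f' (x + \<xi> *\<^sub>R w + t *\<^sub>R z) w - f' x w - L (\<xi> *\<^sub>R w + t *\<^sub>R z)"
    define u' where "u' = f' (x + \<xi> *\<^sub>R w) w - f' x w - L (\<xi> *\<^sub>R w)"
    have "\<bar>u\<bar> \<le> d * norm (\<xi> *\<^sub>R w + t *\<^sub>R z)" "\<bar>u'\<bar> \<le> d * norm (\<xi> *\<^sub>R w)"
      using r(2)[of "x + \<xi> *\<^sub>R w + t *\<^sub>R z"] r(2)[of "x + \<xi> *\<^sub>R w"] bd[of \<xi>] \<xi> tM
      unfolding u_def u'_def by (simp_all add: add.assoc)
    moreover have "d * norm (\<xi> *\<^sub>R w + t *\<^sub>R z) \<le> d * (t * M)" "d * norm (\<xi> *\<^sub>R w) \<le> d * (t * M)"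
      using bd[of \<xi>] \<xi> d by (auto intro!: mult_left_mono)
    ultimately have uu: "\<bar>u - u'\<bar> \<le> 2 * d * M * t" by (simp add: algebra_simps)
    have K: "h t - h 0 = t * (u - u' + t * L z)"
      unfolding \<xi>(3) u_def u'_def using lin by (simp add: linear_add linear_cmul)
    have "(h t - h 0) / t\<^sup>2 - L z = (u - u') / t"
      unfolding K using t by (simp add: field_simps power2_eq_square)
    moreover have "\<bar>(u - u') / t\<bar> \<le> 2 * d * M" using uu t by (simp add: field_simps)
    ultimately show ?thesis using d(2) by (simp add: h_def dist_real_def algebra_simps)
  qed
  show "\<forall>\<^sub>F t in at_right 0. dist ((f (x + t *\<^sub>R w + t *\<^sub>R z) - f (x + t *\<^sub>R w) - f (x + t *\<^sub>R z) + f x) / t\<^sup>2) (L z) < e"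
    unfolding eventually_at_right[OF zero_less_one] using main r'(1) by auto
qed

text \<open>Both sides are limits of the same second difference, which is symmetric in
  \<open>w\<close> and \<open>z\<close>. Components are taken because the mean value theorem behind
  that limit needs real values.\<close>

lemma second_derivative_symmetric:
  fixes f :: "'a::real_normed_vector \<Rightarrow> 'b::euclidean_space"
  assumes "open S" "x \<in> S" "\<And>y. y \<in> S \<Longrightarrow> (f has_derivative f' y) (at y)"
    and "((\<lambda>y. f' y w) has_derivative L) (at x)" "((\<lambda>y. f' y z) has_derivative K) (at x)"
  shows "L z = K w"
proof (rule euclidean_eqI)
  fix b :: 'b
  let ?D = "\<lambda>w z t. (f (x + t *\<^sub>R w + t *\<^sub>R z) \<bullet> b - f (x + t *\<^sub>R w) \<bullet> b - f (x + t *\<^sub>R z) \<bullet> b + f x \<bullet> b) / t\<^sup>2"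
  have df: "((\<lambda>y. f y \<bullet> b) has_derivative (\<lambda>h. f' y h \<bullet> b)) (at y)" if "y \<in> S" for y
    by (rule has_derivative_inner_left[OF assms(3)[OF that]])
  have 1: "(?D w z \<longlongrightarrow> L z \<bullet> b) (at_right 0)"
    by (rule second_difference_limit[OF assms(1,2) df has_derivative_inner_left[OF assms(4)]])
  have 2: "(?D z w \<longlongrightarrow> K w \<bullet> b) (at_right 0)"
    by (rule second_difference_limit[OF assms(1,2) df has_derivative_inner_left[OF assms(5)]])
  have "?D w z = ?D z w" by (rule ext) (simp add: algebra_simps)
  with 1 2 show "L z \<bullet> b = K w \<bullet> b"
    using tendsto_unique[OF trivial_limit_at_right_real 1, of "K w \<bullet> b"] by simp
qed

section \<open>The argument of the determinant\<close>

lemma has_derivative_det_at_one: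
  fixes Y :: "'a::real_normed_vector \<Rightarrow> 'b::real_normed_field ^ 'n ^ 'n"
  assumes "\<And>i j. ((\<lambda>x. Y x $ i $ j) has_derivative (\<lambda>h. Y' h $ i $ j)) (at x)" and one: "Y x = mat 1"
  shows "((\<lambda>x. det (Y x)) has_derivative (\<lambda>h. trace (Y' h))) (at x)"
proof -
  let ?P = "{p. p permutes (UNIV :: 'n set)}"
  let ?t = "\<lambda>h p. of_int (sign p) * (\<Sum>i\<in>UNIV. Y' h $ i $ p i * (\<Prod>j\<in>UNIV - {i}. Y x $ j $ p j))"
  have "((\<lambda>x. det (Y x)) has_derivative (\<lambda>h. \<Sum>p\<in>?P. ?t h p)) (at x)"
    unfolding det_def by (intro has_derivative_sum has_derivative_mult_right has_derivative_prod assms(1))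
  moreover have "(\<Sum>p\<in>?P. ?t h p) = trace (Y' h)" for h
  proof -
    have "?t h p = 0" if p: "p permutes UNIV" "p \<noteq> id" for p
    proof -
      have "(\<Prod>j\<in>UNIV - {i}. Y x $ j $ p j) = 0" for i
      proof -
        \<comment> \<open>A permutation other than the identity moves at least two points, so a zero
          entry survives the removal of the factor \<open>i\<close>.\<close>
        obtain j where "j \<noteq> i" "p j \<noteq> j"
          using p by (metis eq_id_iff permutes_univ)
        then show ?thesis by (intro prod_zero bexI[of _ j]) (auto simp: one mat_def)
      qed
      then show ?thesis by (simp only: mult_zero_right sum.neutral_const)
    qed
    then have "(\<Sum>p\<in>?P. ?t h p) = (\<Sum>p\<in>{id}. ?t h p)"
      by (intro sum.mono_neutral_right) auto
    also have "\<dots> = trace (Y' h)"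
      by (simp add: one mat_def trace_def)
    finally show ?thesis .
  qed
  ultimately show ?thesis by simp
qed

text \<open>Jacobi's formula: multiplying by the inverse \<open>N\<close> of \<open>Z x\<close>
  moves the base point to the identity.\<close>

lemma has_derivative_det:
  fixes Z :: "'a::real_normed_vector \<Rightarrow> 'b::real_normed_field ^ 'n ^ 'n"
  assumes "\<And>i j. ((\<lambda>x. Z x $ i $ j) has_derivative (\<lambda>h. Z' h $ i $ j)) (at x)" and "N ** Z x = mat 1"
  shows "((\<lambda>x. det (Z x)) has_derivative (\<lambda>h. det (Z x) * trace (N ** Z' h))) (at x)"
proof -
  have "det N * det (Z x) = 1" using assms(2) by (metis det_I det_mul)
  then have eq: "det (Z y) = det (Z x) * det (N ** Z y)" for y
    by (simp add: det_mul mult.left_commute)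
  have "((\<lambda>y. (N ** Z y) $ i $ j) has_derivative (\<lambda>h. (N ** Z' h) $ i $ j)) (at x)" for i j
    unfolding matrix_matrix_mult_def by (simp, intro has_derivative_sum has_derivative_mult_right assms(1))
  from has_derivative_det_at_one[OF this assms(2)]
  have "((\<lambda>y. det (Z x) * det (N ** Z y)) has_derivative (\<lambda>h. det (Z x) * trace (N ** Z' h))) (at x)"
    by (rule has_derivative_mult_right)
  then show ?thesis by (simp only: eq[symmetric])
qed

text \<open>Near \<open>x\<close> the imaginary part of \<open>g y - g x\<close> stays below \<pi>
  by continuity, so \<open>g\<close> is \<open>g x\<close> plus the principal logarithm of
  \<open>c y / c x\<close>.\<close>

lemma has_derivative_continuous_logarithm:
  fixes g :: "'a::real_normed_vector \<Rightarrow> complex"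
  assumes "open U" "x \<in> U" "continuous_on U g" "\<And>y. y \<in> U \<Longrightarrow> c y = exp (g y)"
    and "(c has_derivative c') (at x)"
  shows "(g has_derivative (\<lambda>h. c' h / c x)) (at x)"
proof -
  have nz: "c x \<noteq> 0" using assms by simp
  have "isCont g x" using assms continuous_on_eq_continuous_at by blast
  then have "\<forall>\<^sub>F y in at x. dist (g y) (g x) < pi"
    unfolding isCont_def by (rule tendstoD) simp
  then have "\<forall>\<^sub>F y in at x. g x + Ln (c y / c x) = g y"
    using eventually_at_in_open'[OF assms(1,2)]
  proof eventually_elim
    case (elim y)
    have "\<bar>Im (g y - g x)\<bar> < pi" using elim(1) abs_Im_le_cmod[of "g y - g x"] by (simp add: dist_norm)
    then have "Ln (exp (g y - g x)) = g y - g x" by (intro Ln_exp) auto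
    then show ?case using elim(2) assms(2,4) by (simp add: exp_diff)
  qed
  moreover have "((\<lambda>y. g x + Ln (c y / c x)) has_derivative (\<lambda>h. c' h / c x)) (at x)"
  proof -
    have "(Ln has_derivative (\<lambda>h. h)) (at (c x / c x))"
      using has_field_derivative_Ln[of 1] nz by (simp add: has_field_derivative_def mult_1[abs_def])
    moreover have "((\<lambda>y. c y / c x) has_derivative (\<lambda>h. c' h / c x)) (at x)"
      using bounded_linear.has_derivative[OF bounded_linear_divide assms(5)] .
    ultimately have "((\<lambda>y. Ln (c y / c x)) has_derivative (\<lambda>h. c' h / c x)) (at x)"
      by (rule has_derivative_compose[rotated])
    then show ?thesis using has_derivative_add[OF has_derivative_const] by fastforce
  qed
  ultimately show ?thesis
    using nz has_derivative_transform_eventually[of _ _ x UNIV g] by fastforce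
qed

text \<open>The Siegel upper half space, multiplied by \<open>-i\<close>.\<close>

definition siegel_space :: "(complex ^ 'm ^ 'm) set" where
  "siegel_space = {Z. (\<forall>i j. Z $ i $ j = Z $ j $ i) \<and>
     (\<forall>y :: real ^ 'm. y \<noteq> 0 \<longrightarrow> 0 < (\<Sum>i\<in>UNIV. \<Sum>j\<in>UNIV. Re (Z $ i $ j) * y $ i * y $ j))}"

lemma convex_siegel_space: "convex siegel_space"
proof (rule convexI)
  fix Z W :: "complex ^ 'm ^ 'm" and s t :: real
  assume h: "Z \<in> siegel_space" "W \<in> siegel_space" "0 \<le> s" "0 \<le> t" "s + t = 1"
  have "0 < (\<Sum>i\<in>UNIV. \<Sum>j\<in>UNIV. Re ((s *\<^sub>R Z + t *\<^sub>R W) $ i $ j) * y $ i * y $ j)"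
    if "y \<noteq> 0" for y :: "real ^ 'm"
  proof -
    define q where "q Z = (\<Sum>i\<in>UNIV. \<Sum>j\<in>UNIV. Re (Z $ i $ j) * y $ i * y $ j)" for Z :: "complex ^ 'm ^ 'm"
    have "q (s *\<^sub>R Z + t *\<^sub>R W) = s * q Z + t * q W"
      by (simp add: q_def sum_distrib_left sum.distrib algebra_simps)
    moreover have "q Z > 0" "q W > 0" using h(1,2) that by (auto simp: siegel_space_def q_def)
    moreover have "s > 0 \<or> t > 0" using h(3-5) by linarith
    ultimately have "0 < q (s *\<^sub>R Z + t *\<^sub>R W)" using h(3,4)
      by (auto intro: add_pos_nonneg add_nonneg_pos)
    then show ?thesis by (simp only: q_def)
  qed
  moreover have "(s *\<^sub>R Z + t *\<^sub>R W) $ i $ j = (s *\<^sub>R Z + t *\<^sub>R W) $ j $ i" for i j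
  proof -
    have "Z $ i $ j = Z $ j $ i" "W $ i $ j = W $ j $ i"
      using h(1,2) unfolding siegel_space_def by blast+
    then show ?thesis by simp
  qed
  ultimately show "s *\<^sub>R Z + t *\<^sub>R W \<in> siegel_space"
    unfolding siegel_space_def by blast
qed

text \<open>For a kernel vector y = a + i b, symmetry of the imaginary part of \<open>Z\<close>
  cancels the cross terms in the real part of the Hermitian form at y, which leaves the positive
  number \<open>?q a + ?q b\<close>.\<close>

lemma det_siegel_space:
  assumes "Z \<in> siegel_space"
  shows "det Z \<noteq> 0"
proof
  assume "det Z = 0"
  then obtain y where y: "y \<noteq> 0" "Z *v y = 0"
    using invertible_det_nz invertible_left_inverse matrix_left_invertible_ker by metis
  define a b where "a = (\<chi> i. Re (y $ i))" and "b = (\<chi> i. Im (y $ i))"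
  let ?q = "\<lambda>y :: real ^ 'a. \<Sum>i\<in>UNIV. \<Sum>j\<in>UNIV. Re (Z $ i $ j) * y $ i * y $ j"
  have sym: "Z $ i $ j = Z $ j $ i" for i j using assms by (simp add: siegel_space_def)
  have "(\<Sum>i\<in>UNIV. \<Sum>j\<in>UNIV. Im (Z $ i $ j) * b $ i * a $ j)
      = (\<Sum>i\<in>UNIV. \<Sum>j\<in>UNIV. Im (Z $ i $ j) * a $ i * b $ j)"
    by (subst sum.swap) (simp add: sym mult_ac)
  then have "?q a + ?q b = Re (\<Sum>i\<in>UNIV. cnj (y $ i) * (Z *v y) $ i)"
    by (simp add: matrix_vector_mult_def a_def b_def sum_distrib_left algebra_simps
        sum.distrib sum_subtractf)
  also have "\<dots> = 0" by (simp add: y)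
  finally have "?q a + ?q b = 0" .
  moreover have "a \<noteq> 0 \<or> b \<noteq> 0" using y(1) by (auto simp: a_def b_def vec_eq_iff complex_eq_iff)
  moreover have "?q u > 0" if "u \<noteq> 0" for u using assms that by (simp add: siegel_space_def)
  moreover have "?q u \<ge> 0" for u
    by (cases "u = 0") (simp, use calculation(3) less_imp_le in blast)
  ultimately show False
    using add_pos_nonneg[of "?q a" "?q b"] add_nonneg_pos[of "?q a" "?q b"] by fastforce
qed

section \<open>A branch of the argument and its invariance under real congruence\<close>

lemma continuous_on_det [continuous_intros]:
  fixes f :: "'a::topological_space \<Rightarrow> 'b::real_normed_field ^ 'n ^ 'n"
  assumes "continuous_on S f"
  shows "continuous_on S (\<lambda>x. det (f x))"
  unfolding det_def by (intro continuous_intros assms)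

lemma log_det_siegel_space:
  obtains l where "continuous_on siegel_space l" "\<And>Z. Z \<in> siegel_space \<Longrightarrow> det Z = exp (l Z)"
proof (rule continuous_logarithm_on_contractible)
  show "continuous_on siegel_space (det :: complex ^ 'a ^ 'a \<Rightarrow> complex)"
    using continuous_on_det[OF continuous_on_id] by simp
qed (auto intro: convex_imp_contractible convex_siegel_space simp: det_siegel_space)

text \<open>Distinct zeros of sin are at least \<pi> apart, so a continuous path through them stands
  still. This upgrades agreement of arguments modulo \<pi> to equality.\<close>

lemma sin_zero_imp_constant:
  fixes d :: "real \<Rightarrow> real"
  assumes "continuous_on {0..1} d" "\<And>t. t \<in> {0..1} \<Longrightarrow> sin (d t) = 0"
  shows "d 0 = d 1"
proof -
  have "d constant_on {0..1}"
  proof (rule continuous_discrete_range_constant[OF _ assms(1)])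
    fix s :: real assume s: "s \<in> {0..1}"
    have "pi \<le> norm (d t - d s)" if t: "t \<in> {0..1}" "d t \<noteq> d s" for t
    proof -
      obtain i j :: int where ij: "d s = of_int i * pi" "d t = of_int j * pi"
        using assms(2)[OF s] assms(2)[OF t(1)] by (auto simp: sin_zero_iff_int2)
      then have "i \<noteq> j" using t by auto
      then have "1 * pi \<le> \<bar>of_int (j - i)\<bar> * pi" by (intro mult_right_mono) (simp_all flip: of_int_abs)
      then show ?thesis by (simp add: ij abs_mult flip: left_diff_distrib)
    qed
    then show "\<exists>e>0. \<forall>t. t \<in> {0..1} \<and> d t \<noteq> d s \<longrightarrow> e \<le> norm (d t - d s)"
      using pi_gt_zero by blast
  qed simp
  then show ?thesis unfolding constant_on_def by fastforce
qed

text \<open>Scaling the imaginary part down to \<open>0\<close> reduces the claim to real positive definite matrices,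
  where the argument of the determinant is a constant multiple of \<open>\<pi>\<close>.\<close>

lemma Im_log_det_congruence:
  fixes \<tau> :: "real ^ 'm ^ 'm"
  assumes l: "continuous_on siegel_space l" "\<And>Z. Z \<in> siegel_space \<Longrightarrow> det Z = exp (l Z)"
    and Z: "Z \<in> siegel_space" "W \<in> siegel_space"
    and W: "\<And>i j. W $ i $ j = (\<Sum>k\<in>UNIV. \<Sum>m\<in>UNIV. of_real (\<tau> $ k $ i) * Z $ k $ m * of_real (\<tau> $ m $ j))"
  shows "Im (l W) = Im (l Z)"
proof -
  define r :: "complex ^ 'm ^ 'm \<Rightarrow> real \<Rightarrow> complex ^ 'm ^ 'm"
    where "r X t = (\<chi> i j. Complex (Re (X $ i $ j)) (t * Im (X $ i $ j)))" for X t
  define T :: "complex ^ 'm ^ 'm" where "T = (\<chi> i j. of_real (\<tau> $ i $ j))"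
  have det_of_real: "det (\<chi> i j. complex_of_real (A $ i $ j)) = of_real (det A)" for A :: "real ^ 'm ^ 'm"
    by (simp add: det_def)
  then have detT: "det T = of_real (det \<tau>)" by (simp add: T_def)
  have rS: "r X t \<in> siegel_space" if "X \<in> siegel_space" for X t
    using that by (auto simp: siegel_space_def r_def)
  have cont: "continuous_on {0..1} (\<lambda>t. Im (l (p t)))"
    if "continuous_on {0..1} p" "\<And>t. t \<in> {0..1} \<Longrightarrow> p t \<in> siegel_space" for p :: "real \<Rightarrow> _"
    using that by (intro continuous_intros continuous_on_compose2[OF l(1)]) auto
  have cont_r: "continuous_on {0..1} (r X)" for X
    unfolding r_def Complex_eq by (intro continuous_intros)
  have rW: "det (r W t) = of_real ((det \<tau>)\<^sup>2) * det (r Z t)" for t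
  proof -
    \<comment> \<open>A real congruence commutes with scaling the imaginary part, so
      \<open>W\<close> and \<open>Z\<close> can be deformed together.\<close>
    have "r W t = transpose T ** r Z t ** T"
    proof (intro vec_eq_iff[THEN iffD2] allI)
      fix i j
      have "(transpose T ** r Z t ** T) $ i $ j
          = (\<Sum>m\<in>UNIV. \<Sum>k\<in>UNIV. of_real (\<tau> $ k $ i) * r Z t $ k $ m * of_real (\<tau> $ m $ j))"
        by (simp add: matrix_matrix_mult_def transpose_def T_def sum_distrib_right)
      also have "\<dots> = (\<Sum>k\<in>UNIV. \<Sum>m\<in>UNIV. of_real (\<tau> $ k $ i) * r Z t $ k $ m * of_real (\<tau> $ m $ j))"
        by (rule sum.swap)
      also have "\<dots> = r W t $ i $ j"
        by (simp add: r_def W complex_eq_iff sum_distrib_left mult_ac)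
      finally show "r W t $ i $ j = (transpose T ** r Z t ** T) $ i $ j" by simp
    qed
    then show ?thesis by (simp add: det_mul detT power2_eq_square)
  qed
  have sin0: "sin (Im z) = 0" if "exp z \<in> \<real>" for z
    using that by (auto simp: complex_is_Real_iff Im_exp)
  have "Im (l (r W 0)) - Im (l (r Z 0)) = Im (l (r W 1)) - Im (l (r Z 1))"
  proof (rule sin_zero_imp_constant)
    show "continuous_on {0..1} (\<lambda>t. Im (l (r W t)) - Im (l (r Z t)))"
      by (intro continuous_on_diff cont cont_r rS Z)
    fix t :: real
    have "exp (l (r W t) - l (r Z t)) = of_real ((det \<tau>)\<^sup>2)"
      using rW[of t] rS[OF Z(1), of t] rS[OF Z(2), of t] det_siegel_space[OF rS[OF Z(1)], of t]
      by (simp add: exp_diff flip: l(2))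
    then show "sin (Im (l (r W t)) - Im (l (r Z t))) = 0"
      using sin0[of "l (r W t) - l (r Z t)"] by (simp add: Reals_of_real del: of_real_power)
  qed
  \<comment> \<open>Both matrices are real, but their arguments could still be different multiples
    of \<pi>. The segment joining them stays in the convex \<open>siegel_space\<close> and has real
    determinants, which excludes this.\<close>
  moreover have "Im (l (r W 0)) = Im (l (r Z 0))"
  proof -
    define p where "p t = (1 - t) *\<^sub>R r W 0 + t *\<^sub>R r Z 0" for t
    have pS: "p t \<in> siegel_space" if "t \<in> {0..1}" for t
      unfolding p_def using that by (intro convexD_alt[OF convex_siegel_space] rS Z) auto
    have "Im (l (p 0)) = Im (l (p 1))"
    proof (rule sin_zero_imp_constant[OF cont])
      show "continuous_on {0..1} p" unfolding p_def by (intro continuous_intros)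
      fix t :: real assume t: "t \<in> {0..1}"
      have "p t = (\<chi> i j. of_real (Re (p t $ i $ j)))"
        by (simp add: p_def r_def vec_eq_iff complex_eq_iff)
      from arg_cong[OF this, of det] have "det (p t) = of_real (det (\<chi> i j. Re (p t $ i $ j)))"
        using det_of_real[of "\<chi> i j. Re (p t $ i $ j)"] by (simp only: vec_lambda_beta)
      then show "sin (Im (l (p t))) = 0" using l(2)[OF pS[OF t]] by (intro sin0) simp
    qed (rule pS)
    then show ?thesis by (simp add: p_def)
  qed
  moreover have "r X 1 = X" for X by (simp add: r_def vec_eq_iff)
  ultimately show ?thesis by simp
qed

section \<open>Linear algebra of a Lagrangian plane\<close>

lemma orthonormal_family_parseval:
  fixes \<beta> :: "'i \<Rightarrow> 'w::euclidean_space"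
  assumes "finite I" "DIM('w) \<le> card I"
    and on: "\<And>i j. i \<in> I \<Longrightarrow> j \<in> I \<Longrightarrow> \<beta> i \<bullet> \<beta> j = (if i = j then 1 else 0)"
  shows "(\<Sum>i\<in>I. (y \<bullet> \<beta> i) * (z \<bullet> \<beta> i)) = y \<bullet> z"
proof -
  have inj: "inj_on \<beta> I"
    using on by (intro inj_onI) (metis zero_neq_one)
  have orth: "pairwise orthogonal (\<beta> ` I)"
    using on by (auto simp: pairwise_def orthogonal_def)
  have norm: "norm u = 1" if "u \<in> \<beta> ` I" for u
    using that on by (auto simp: norm_eq_1)
  then have "0 \<notin> \<beta> ` I" by force
  then have "independent (\<beta> ` I)" using orth pairwise_orthogonal_independent by blast
  moreover have "dim (UNIV :: 'w set) \<le> card (\<beta> ` I)" using assms(2) inj by (simp add: card_image)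
  ultimately have "y \<in> span (\<beta> ` I)"
    using card_ge_dim_independent by blast
  from orthonormal_basis_expand[OF orth norm this] assms(1)
  have "y = (\<Sum>u\<in>\<beta> ` I. (y \<bullet> u) *\<^sub>R u)" by simp
  also have "\<dots> = (\<Sum>i\<in>I. (y \<bullet> \<beta> i) *\<^sub>R \<beta> i)" by (simp add: sum.reindex[OF inj])
  finally have "y \<bullet> z = (\<Sum>i\<in>I. (y \<bullet> \<beta> i) *\<^sub>R \<beta> i) \<bullet> z" by (rule arg_cong)
  then have "y \<bullet> z = (\<Sum>i\<in>I. (y \<bullet> \<beta> i) * (\<beta> i \<bullet> z))"
    by (simp only: inner_sum_left inner_scaleR_left)
  then show ?thesis by (simp only: inner_commute[of z])
qed

lemma inner_span_eq_0:
  fixes d :: "'v::real_inner"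
  assumes "y \<in> span S" "\<And>z. z \<in> S \<Longrightarrow> d \<bullet> z = 0"
  shows "d \<bullet> y = 0"
  using assms(1) by (induction rule: span_induct_alt) (simp_all add: inner_add_right assms(2))

text \<open>The vectors \<open>a e + i b e\<close> form a unitary basis of the complexification of the orthogonal
  complement of \<open>x, v\<close>.\<close>

locale lagrangian_frame =
  fixes E :: "'e set" and a b :: "'e \<Rightarrow> 'v::euclidean_space" and x v :: 'v
  assumes fin: "finite E" and card: "DIM('v) \<le> card E + 2"
    and xv: "x \<bullet> x = 1" "v \<bullet> v = 1" "x \<bullet> v = 0"
    and perp: "\<And>e. a e \<bullet> x = 0" "\<And>e. a e \<bullet> v = 0" "\<And>e. b e \<bullet> x = 0" "\<And>e. b e \<bullet> v = 0"
    and orthonormal: "\<And>e e'. e \<in> E \<Longrightarrow> e' \<in> E \<Longrightarrow> a e \<bullet> a e' + b e \<bullet> b e' = (if e = e' then 1 else 0)"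
    and lagrangian: "\<And>e e'. a e \<bullet> b e' = b e \<bullet> a e'"
begin

text \<open>The pairs (a e, b e), their multiples (b e, - a e) by -i, and x, v placed in either
  factor are orthonormal; the first two families are orthogonal by \<open>lagrangian\<close>. There
  are at least twice \<open>DIM('v)\<close> of them, so they form a basis.\<close>

lemma parseval_prod:
  "(\<Sum>e\<in>E. (fst Y \<bullet> a e + snd Y \<bullet> b e) * (fst Z \<bullet> a e + snd Z \<bullet> b e))
   + (\<Sum>e\<in>E. (fst Y \<bullet> b e - snd Y \<bullet> a e) * (fst Z \<bullet> b e - snd Z \<bullet> a e))
   + ((fst Y \<bullet> x) * (fst Z \<bullet> x) + (fst Y \<bullet> v) * (fst Z \<bullet> v)
   + (snd Y \<bullet> x) * (snd Z \<bullet> x) + (snd Y \<bullet> v) * (snd Z \<bullet> v)) = Y \<bullet> Z"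
proof -
  define \<beta> :: "('e + 'e) + (bool \<times> bool) \<Rightarrow> 'v \<times> 'v" where
    "\<beta> = case_sum (case_sum (\<lambda>e. (a e, b e)) (\<lambda>e. (b e, - a e)))
       (\<lambda>(s, t). if s then (if t then x else v, 0) else (0, if t then x else v))"
  let ?I = "(E <+> E) <+> (UNIV :: (bool \<times> bool) set)"
  have vx: "v \<bullet> x = 0" using xv(3) by (simp add: inner_commute)
  have perp': "x \<bullet> a e = 0" "v \<bullet> a e = 0" "x \<bullet> b e = 0" "v \<bullet> b e = 0" for e
    using perp by (simp_all add: inner_commute)
  have lag: "b e \<bullet> b e' + a e \<bullet> a e' = (if e = e' then 1 else 0)" if "e \<in> E" "e' \<in> E" for e e'
    using orthonormal[OF that] by simp
  have "\<beta> i \<bullet> \<beta> j = (if i = j then 1 else 0)" if "i \<in> ?I" "j \<in> ?I" for i j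
    using that by (auto simp: \<beta>_def orthonormal lag lagrangian xv vx perp perp' split: if_splits)
  from orthonormal_family_parseval[OF _ _ this, of ?I Y Z]
  have "(\<Sum>i\<in>?I. (Y \<bullet> \<beta> i) * (Z \<bullet> \<beta> i)) = Y \<bullet> Z"
    using fin card by (simp add: card_Plus UNIV_Times_UNIV[symmetric] card_cartesian_product del: UNIV_Times_UNIV)
  moreover have "(\<Sum>p\<in>(UNIV :: (bool \<times> bool) set). f p)
      = f (True, True) + f (True, False) + f (False, True) + f (False, False)" for f :: "_ \<Rightarrow> real"
    unfolding UNIV_Times_UNIV[symmetric] sum.cartesian_product[symmetric, of "\<lambda>s t. f (s, t)", simplified]
    by (simp add: UNIV_bool)
  ultimately show ?thesis
    using fin by (simp add: sum.Plus \<beta>_def inner_prod_def)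
qed

lemma parseval:
  assumes "y \<bullet> x = 0" "y \<bullet> v = 0"
  shows "(\<Sum>e\<in>E. (y \<bullet> a e) * (z \<bullet> a e)) + (\<Sum>e\<in>E. (y \<bullet> b e) * (z \<bullet> b e)) = y \<bullet> z"
  using parseval_prod[of "(y, 0)" "(z, 0)"] assms by simp

text \<open>The imaginary part of the completeness relation of the unitary basis, of which
  \<open>parseval\<close> is the real part.\<close>

lemma commute: "(\<Sum>e\<in>E. (y \<bullet> a e) * (z \<bullet> b e)) = (\<Sum>e\<in>E. (y \<bullet> b e) * (z \<bullet> a e))"
  using parseval_prod[of "(y, 0)" "(0, z)"] by (simp add: sum_negf)

end

text \<open>\<open>P\<close> is the coordinate basis of the tangent space of \<open>M\<close>, \<open>q\<close> its dual basis, \<open>h\<close> the second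
  fundamental form in direction \<open>v\<close>, and \<open>r e\<close> the coordinates of \<open>a e\<close>.\<close>

locale chart_frame = lagrangian_frame E a b x v
  for E :: "'e set" and a b :: "'e \<Rightarrow> 'v::euclidean_space" and x v :: 'v +
  fixes P :: "'m::finite \<Rightarrow> 'v" and h :: "'m \<Rightarrow> 'm \<Rightarrow> real" and r :: "'e \<Rightarrow> real ^ 'm"
    and q :: "'m \<Rightarrow> 'v"
  assumes P_perp: "P i \<bullet> x = 0" "P i \<bullet> v = 0"
    and q_span: "q i \<in> span (range P)" and q_dual: "q i \<bullet> P j = (if i = j then 1 else 0)"
    and h_sym: "h i j = h j i"
    and a_eq: "a e = (\<Sum>i\<in>UNIV. (r e $ i) *\<^sub>R P i)"
    and weingarten: "b e \<bullet> P i = - (\<Sum>j\<in>UNIV. h i j * (r e $ j))"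
begin

definition Z :: "complex ^ 'm ^ 'm" where
  "Z = (\<chi> i j. Complex (P i \<bullet> P j) (h i j))"

text \<open>By \<open>a_eq\<close> and \<open>weingarten\<close>, \<open>Z\<close> sends
  \<open>r e\<close> to the vector with entries (a e - i b e) \<bullet> P i. Completeness of the
  unitary basis then makes the sum over e of the column \<open>r e\<close>, with entries q i
  \<bullet> a e, times the row (a e + i b e) \<bullet> q j an inverse.\<close>

definition Zinv :: "complex ^ 'm ^ 'm" where
  "Zinv = (\<chi> i j. Complex (\<Sum>e\<in>E. (q i \<bullet> a e) * (q j \<bullet> a e)) (\<Sum>e\<in>E. (q i \<bullet> a e) * (q j \<bullet> b e)))"

text \<open>The shape operator in direction \<open>v\<close> applied to \<open>P l\<close>: indeed s
  l \<bullet> P j = h j l.\<close>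

definition s :: "'m \<Rightarrow> 'v" where "s l = (\<Sum>j\<in>UNIV. h j l *\<^sub>R q j)"

lemma q_perp: "q i \<bullet> x = 0" "q i \<bullet> v = 0"
proof -
  have "x \<bullet> q i = 0" "v \<bullet> q i = 0"
    by (rule inner_span_eq_0[OF q_span]; auto simp: inner_commute[of _ "P _"] P_perp)+
  then show "q i \<bullet> x = 0" "q i \<bullet> v = 0" by (simp_all add: inner_commute)
qed

lemma expand:
  assumes "y \<in> span (range P)"
  shows "y = (\<Sum>i\<in>UNIV. (y \<bullet> P i) *\<^sub>R q i)" and "y = (\<Sum>i\<in>UNIV. (y \<bullet> q i) *\<^sub>R P i)"
proof -
  have orth: "d = 0" if d: "d \<in> span (range P)" "\<And>i. d \<bullet> P i = 0" for d
    using inner_span_eq_0[OF d(1), of d] d(2) by auto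
  have 1: "y = (\<Sum>i\<in>UNIV. (y \<bullet> P i) *\<^sub>R q i)" if "y \<in> span (range P)" for y
  proof -
    have "y - (\<Sum>i\<in>UNIV. (y \<bullet> P i) *\<^sub>R q i) = 0"
    proof (rule orth)
      show "y - (\<Sum>i\<in>UNIV. (y \<bullet> P i) *\<^sub>R q i) \<in> span (range P)"
        by (intro span_diff that span_sum span_scale q_span)
    qed (simp add: inner_diff_left inner_sum_left q_dual if_distrib cong: if_cong)
    then show ?thesis by simp
  qed
  then show "y = (\<Sum>i\<in>UNIV. (y \<bullet> P i) *\<^sub>R q i)" using assms .
  define d where "d = y - (\<Sum>i\<in>UNIV. (y \<bullet> q i) *\<^sub>R P i)"
  have "d \<in> span (range P)"
    unfolding d_def by (intro span_diff assms span_sum span_scale span_base) simp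
  moreover have "d \<bullet> q j = 0" for j
  proof -
    have "(\<Sum>i\<in>UNIV. (y \<bullet> q i) * (P i \<bullet> q j)) = (\<Sum>i\<in>UNIV. if i = j then y \<bullet> q j else 0)"
      by (rule sum.cong) (auto simp: inner_commute[of "P _"] q_dual)
    then show ?thesis by (simp add: d_def inner_diff_left inner_sum_left)
  qed
  \<comment> \<open>\<open>d\<close> is orthogonal to every \<open>q j\<close>, yet by the first
    expansion it is a combination of them.\<close>
  ultimately have "d \<bullet> d = 0"
    using arg_cong[OF 1[of d], of "inner d"] by (simp add: inner_sum_right)
  then show "y = (\<Sum>i\<in>UNIV. (y \<bullet> q i) *\<^sub>R P i)" by (simp add: d_def)
qed

lemma r_eq: "r e $ i = q i \<bullet> a e"
  by (simp add: a_eq inner_sum_right q_dual if_distrib cong: if_cong)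

lemma inner_a: "y \<bullet> a e = (\<Sum>i\<in>UNIV. (q i \<bullet> a e) * (y \<bullet> P i))"
  by (subst a_eq) (simp add: inner_sum_right r_eq)

lemma a_span: "a e \<in> span (range P)"
  unfolding a_eq by (intro span_sum span_scale span_base) simp

lemma s_a: "s l \<bullet> a e = - (P l \<bullet> b e)"
  by (simp add: s_def inner_sum_left r_eq[symmetric] inner_commute[of "P l"] weingarten h_sym[of l])

lemma P_expand: "P l = (\<Sum>j\<in>UNIV. (P j \<bullet> P l) *\<^sub>R q j)"
  using expand(1)[OF span_base, of "P l"] by (simp add: inner_commute)

text \<open>The real part of \<open>Zinv ** Z = mat 1\<close>: \<open>commute\<close> and
  \<open>s_a\<close> turn the terms with \<open>s l\<close> into the b-half of
  \<open>parseval\<close>.\<close>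

lemma q_frame: "(\<Sum>e\<in>E. (q i \<bullet> a e) * (P l \<bullet> a e - s l \<bullet> b e)) = (if i = l then 1 else 0)"
proof -
  have "(\<Sum>e\<in>E. (q i \<bullet> a e) * (s l \<bullet> b e)) = - (\<Sum>e\<in>E. (q i \<bullet> b e) * (P l \<bullet> b e))"
    by (simp add: commute s_a sum_negf)
  then have "(\<Sum>e\<in>E. (q i \<bullet> a e) * (P l \<bullet> a e - s l \<bullet> b e)) = q i \<bullet> P l"
    using parseval[OF q_perp, of i "P l"] by (simp add: right_diff_distrib sum_subtractf)
  then show ?thesis by (simp add: q_dual)
qed

lemma Zinv_mult: "Zinv ** Z = mat 1"
proof -
  have "(Zinv ** Z) $ i $ l = (if i = l then 1 else 0)" for i l
  proof -
    have P: "P l \<bullet> y = (\<Sum>j\<in>UNIV. (P j \<bullet> P l) * (q j \<bullet> y))" for y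
      using arg_cong[OF P_expand[of l], of "\<lambda>u. u \<bullet> y"] by (simp add: inner_sum_left)
    have s: "s l \<bullet> y = (\<Sum>j\<in>UNIV. h j l * (q j \<bullet> y))" for y
      by (simp add: s_def inner_sum_left)
    have "Re ((Zinv ** Z) $ i $ l) = (\<Sum>j\<in>UNIV. \<Sum>e\<in>E. (q i \<bullet> a e) * ((P j \<bullet> P l) * (q j \<bullet> a e) - h j l * (q j \<bullet> b e)))"
      by (simp add: matrix_matrix_mult_def Zinv_def Z_def sum_distrib_left sum_distrib_right
          right_diff_distrib sum_subtractf mult_ac)
    also have "\<dots> = (\<Sum>e\<in>E. (q i \<bullet> a e) * (P l \<bullet> a e - s l \<bullet> b e))"
      by (subst sum.swap) (simp add: P s sum_distrib_left right_diff_distrib sum_subtractf)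
    finally have Re: "Re ((Zinv ** Z) $ i $ l) = (if i = l then 1 else 0)" by (simp add: q_frame)
    have "Im ((Zinv ** Z) $ i $ l) = (\<Sum>j\<in>UNIV. \<Sum>e\<in>E. (q i \<bullet> a e) * ((P j \<bullet> P l) * (q j \<bullet> b e) + h j l * (q j \<bullet> a e)))"
      by (simp add: matrix_matrix_mult_def Zinv_def Z_def sum_distrib_left sum_distrib_right
          distrib_left sum.distrib mult_ac)
    also have "\<dots> = (\<Sum>e\<in>E. (q i \<bullet> a e) * (P l \<bullet> b e + s l \<bullet> a e))"
      by (subst sum.swap) (simp add: P s sum_distrib_left distrib_left sum.distrib)
    finally have "Im ((Zinv ** Z) $ i $ l) = 0" by (simp add: s_a)
    with Re show ?thesis by (auto simp: complex_eq_iff)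
  qed
  then show ?thesis by (simp add: vec_eq_iff mat_def)
qed

text \<open>The real part is the Gram matrix of the \<open>P i\<close>, whose independence is
  witnessed by the dual family \<open>q\<close>.\<close>

lemma Z_siegel: "Z \<in> siegel_space"
proof -
  have "0 < (\<Sum>i\<in>UNIV. \<Sum>j\<in>UNIV. (P i \<bullet> P j) * y $ i * y $ j)" if "y \<noteq> 0" for y
  proof -
    define p where "p = (\<Sum>i\<in>UNIV. (y $ i) *\<^sub>R P i)"
    have "q i \<bullet> p = y $ i" for i
      by (simp add: p_def inner_sum_right q_dual if_distrib cong: if_cong)
    then have "p \<noteq> 0" using that by (auto simp: vec_eq_iff)
    then have "0 < p \<bullet> p" by simp
    also have "p \<bullet> p = (\<Sum>i\<in>UNIV. \<Sum>j\<in>UNIV. (P i \<bullet> P j) * y $ i * y $ j)"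
      unfolding p_def inner_sum_left inner_sum_right
      by (simp add: mult_ac inner_commute)
    finally show ?thesis .
  qed
  then show ?thesis
    unfolding siegel_space_def Z_def by (auto simp: inner_commute h_sym complex_eq_iff)
qed

text \<open>The primed letters are derivatives in one fixed direction. Differentiating the Weingarten
  equation produces the error \<open>- 2 Pr e \<bullet> b e\<close>, where \<open>Pr e\<close> is the derivative of the tangent frame
  alone; the derivative of the first fundamental form cancels it.\<close>

lemma Im_trace_log_derivative:
  assumes da: "\<And>e. a' e = (\<Sum>i\<in>UNIV. (r' e $ i) *\<^sub>R P i + (r e $ i) *\<^sub>R P' i)"
    and db: "\<And>e i. b' e \<bullet> P i + b e \<bullet> P' i = - (\<Sum>j\<in>UNIV. h' i j * (r e $ j) + h i j * (r' e $ j))"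
    and Z': "\<And>i j. Z' $ i $ j = Complex (P' i \<bullet> P j + P i \<bullet> P' j) (h' i j)"
  shows "Im (trace (Zinv ** Z')) = (\<Sum>e\<in>E. a' e \<bullet> b e - b' e \<bullet> a e)"
proof -
  define Pr where "Pr e = (\<Sum>i\<in>UNIV. (r e $ i) *\<^sub>R P' i)" for e
  have h': "(\<Sum>i\<in>UNIV. \<Sum>j\<in>UNIV. h' i j * (q i \<bullet> a e) * (q j \<bullet> a e)) = a' e \<bullet> b e - b' e \<bullet> a e - 2 * (Pr e \<bullet> b e)" for e
  proof -
    have "(\<Sum>i\<in>UNIV. \<Sum>j\<in>UNIV. h' i j * (q i \<bullet> a e) * (q j \<bullet> a e))
       = (\<Sum>i\<in>UNIV. (r e $ i) * (- (b' e \<bullet> P i + b e \<bullet> P' i) - (\<Sum>j\<in>UNIV. h i j * (r' e $ j))))"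
      unfolding db by (simp add: sum.distrib sum_distrib_left r_eq mult_ac)
    also have "\<dots> = - (b' e \<bullet> a e) - b e \<bullet> Pr e - (\<Sum>i\<in>UNIV. \<Sum>j\<in>UNIV. (r e $ i) * (h i j * (r' e $ j)))"
      by (simp add: inner_a[of "b' e"] Pr_def inner_sum_right sum_negf sum.distrib sum_subtractf sum_distrib_left
          algebra_simps flip: r_eq)
    also have "(\<Sum>i\<in>UNIV. \<Sum>j\<in>UNIV. (r e $ i) * (h i j * (r' e $ j))) = - (\<Sum>j\<in>UNIV. (r' e $ j) * (b e \<bullet> P j))"
      unfolding weingarten by (subst sum.swap) (simp add: sum_distrib_left sum_negf h_sym mult_ac)
    also have "(\<Sum>j\<in>UNIV. (r' e $ j) * (b e \<bullet> P j)) = b e \<bullet> (a' e - Pr e)"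
      unfolding da Pr_def by (simp add: sum.distrib inner_sum_right)
    finally show ?thesis by (simp add: inner_diff_right inner_commute)
  qed
  have G1: "(\<Sum>e\<in>E. \<Sum>i\<in>UNIV. \<Sum>j\<in>UNIV. (q i \<bullet> a e) * (q j \<bullet> b e) * (P' j \<bullet> P i)) = (\<Sum>e\<in>E. Pr e \<bullet> b e)"
  proof -
    have "(\<Sum>i\<in>UNIV. \<Sum>j\<in>UNIV. (q i \<bullet> a e) * (q j \<bullet> b e) * (P' j \<bullet> P i)) = (\<Sum>j\<in>UNIV. (q j \<bullet> b e) * (P' j \<bullet> a e))" for e
      by (subst sum.swap) (simp add: inner_a[of "P' _"] sum_distrib_left mult_ac)
    then have "(\<Sum>e\<in>E. \<Sum>i\<in>UNIV. \<Sum>j\<in>UNIV. (q i \<bullet> a e) * (q j \<bullet> b e) * (P' j \<bullet> P i))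
        = (\<Sum>j\<in>UNIV. \<Sum>e\<in>E. (q j \<bullet> b e) * (P' j \<bullet> a e))"
      by (simp add: sum.swap[of _ E])
    also have "\<dots> = (\<Sum>e\<in>E. \<Sum>j\<in>UNIV. (q j \<bullet> a e) * (P' j \<bullet> b e))"
      by (simp add: commute[symmetric] sum.swap[of _ E])
    finally show ?thesis by (simp add: Pr_def inner_sum_left r_eq)
  qed
  have G2: "(\<Sum>e\<in>E. \<Sum>i\<in>UNIV. \<Sum>j\<in>UNIV. (q i \<bullet> a e) * (q j \<bullet> b e) * (P j \<bullet> P' i)) = (\<Sum>e\<in>E. Pr e \<bullet> b e)"
  proof -
    \<comment> \<open>\<open>n i\<close> is the part of \<open>P' i\<close> orthogonal to all
      \<open>P l\<close>, hence to all \<open>a e\<close>. By \<open>commute\<close> it drops out of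
      the sum against \<open>b e\<close>, so only the tangential part of \<open>P' i\<close>
      counts.\<close>
    define n where "n i = P' i - (\<Sum>j\<in>UNIV. (P j \<bullet> P' i) *\<^sub>R q j)" for i
    have "n i \<bullet> P l = 0" for i l
      by (simp add: n_def inner_diff_left inner_sum_left q_dual inner_commute[of "P l"] if_distrib cong: if_cong)
    then have "n i \<bullet> a e = 0" for i e
      by (simp add: inner_a[of "n _"])
    then have "(\<Sum>e\<in>E. (q i \<bullet> a e) * (n i \<bullet> b e)) = 0" for i
      by (simp add: commute)
    then have "(\<Sum>e\<in>E. (q i \<bullet> a e) * (P' i \<bullet> b e)) = (\<Sum>e\<in>E. \<Sum>j\<in>UNIV. (q i \<bullet> a e) * (q j \<bullet> b e) * (P j \<bullet> P' i))" for i
      by (simp add: n_def inner_diff_left inner_sum_left right_diff_distrib sum_subtractf sum_distrib_left mult_ac)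
    then have "(\<Sum>i\<in>UNIV. \<Sum>e\<in>E. (q i \<bullet> a e) * (P' i \<bullet> b e))
       = (\<Sum>i\<in>UNIV. \<Sum>e\<in>E. \<Sum>j\<in>UNIV. (q i \<bullet> a e) * (q j \<bullet> b e) * (P j \<bullet> P' i))" by simp
    then show ?thesis
      by (simp add: sum.swap[of _ E] Pr_def inner_sum_left r_eq)
  qed
  have "Im (trace (Zinv ** Z')) = (\<Sum>i\<in>UNIV. \<Sum>j\<in>UNIV. \<Sum>e\<in>E. h' j i * (q i \<bullet> a e) * (q j \<bullet> a e)
      + (q i \<bullet> a e) * (q j \<bullet> b e) * (P' j \<bullet> P i) + (q i \<bullet> a e) * (q j \<bullet> b e) * (P j \<bullet> P' i))"
    by (simp add: trace_def matrix_matrix_mult_def Zinv_def Z' sum_distrib_left sum_distrib_right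
        sum.distrib algebra_simps)
  also have "\<dots> = (\<Sum>e\<in>E. \<Sum>i\<in>UNIV. \<Sum>j\<in>UNIV. h' j i * (q i \<bullet> a e) * (q j \<bullet> a e)
      + (q i \<bullet> a e) * (q j \<bullet> b e) * (P' j \<bullet> P i) + (q i \<bullet> a e) * (q j \<bullet> b e) * (P j \<bullet> P' i))"
    by (simp add: sum.swap[of _ E])
  also have "\<dots> = (\<Sum>e\<in>E. \<Sum>i\<in>UNIV. \<Sum>j\<in>UNIV. h' j i * (q i \<bullet> a e) * (q j \<bullet> a e)) + 2 * (\<Sum>e\<in>E. Pr e \<bullet> b e)"
    using G1 G2 by (simp add: sum.distrib)
  also have "(\<Sum>e\<in>E. \<Sum>i\<in>UNIV. \<Sum>j\<in>UNIV. h' j i * (q i \<bullet> a e) * (q j \<bullet> a e))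
      = (\<Sum>e\<in>E. \<Sum>i\<in>UNIV. \<Sum>j\<in>UNIV. h' i j * (q i \<bullet> a e) * (q j \<bullet> a e))"
    by (rule sum.cong[OF refl], subst sum.swap) (simp add: mult_ac)
  also have "\<dots> = (\<Sum>e\<in>E. a' e \<bullet> b e - b' e \<bullet> a e) - 2 * (\<Sum>e\<in>E. Pr e \<bullet> b e)"
    by (simp add: h' sum_subtractf sum_distrib_left)
  finally show ?thesis by simp
qed

lemma P_eq_a: "P l = (\<Sum>e\<in>E. (P l \<bullet> a e - s l \<bullet> b e) *\<^sub>R a e)"
proof -
  have "P l = (\<Sum>i\<in>UNIV. (\<Sum>e\<in>E. (q i \<bullet> a e) * (P l \<bullet> a e - s l \<bullet> b e)) *\<^sub>R P i)"
    by (simp add: q_frame if_distrib[of "\<lambda>c. c *\<^sub>R _"] cong: if_cong)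
  also have "\<dots> = (\<Sum>e\<in>E. (P l \<bullet> a e - s l \<bullet> b e) *\<^sub>R (\<Sum>i\<in>UNIV. (q i \<bullet> a e) *\<^sub>R P i))"
    unfolding scaleR_sum_left scaleR_sum_right by (subst sum.swap) (simp add: mult.commute)
  also have "\<dots> = (\<Sum>e\<in>E. (P l \<bullet> a e - s l \<bullet> b e) *\<^sub>R a e)"
    by (simp only: r_eq[symmetric] a_eq[symmetric])
  finally show ?thesis .
qed

end

text \<open>Both charts share \<open>a\<close> and \<open>b\<close>, so the transformation of h can
  be read off from the two Weingarten equations, and no second derivative of a transition map
  enters. \<open>\<tau>\<close> expresses \<open>P2\<close> in the basis \<open>P1\<close>.\<close>

lemma chart_frame_change:
  assumes "chart_frame E a b x v P1 h1 r1 q1" "chart_frame E a b x v P2 h2 r2 q2"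
  defines "\<tau> \<equiv> (\<chi> i j. q1 i \<bullet> P2 j)"
  shows "chart_frame.Z P2 h2 $ j $ l
    = (\<Sum>i\<in>UNIV. \<Sum>k\<in>UNIV. of_real (\<tau> $ i $ j) * chart_frame.Z P1 h1 $ i $ k * of_real (\<tau> $ k $ l))"
proof -
  interpret c1: chart_frame E a b x v P1 h1 r1 q1 by fact
  interpret c2: chart_frame E a b x v P2 h2 r2 q2 by fact
  \<comment> \<open>\<open>t l\<close> lifts \<open>P2 l\<close> to the normal bundle: it combines
    the \<open>a e\<close> to \<open>P2 l\<close>, and the same combination of the
    \<open>b e\<close> is the derivative of the normal along that lift.\<close>
  define t where "t l e = P2 l \<bullet> a e - c2.s l \<bullet> b e" for l e
  have P2: "P2 l = (\<Sum>e\<in>E. t l e *\<^sub>R a e)" for l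
    unfolding t_def by (rule c2.P_eq_a)
  then have "P2 l \<in> span (range P1)" for l
    by (metis (no_types, lifting) c1.a_span span_scale span_sum)
  then have P21: "P2 l = (\<Sum>i\<in>UNIV. (\<tau> $ i $ l) *\<^sub>R P1 i)" for l
    using c1.expand(2)[of "P2 l"] by (simp add: \<tau>_def inner_commute)
  have \<tau>: "\<tau> $ k $ l = (\<Sum>e\<in>E. t l e * (r1 e $ k))" for k l
    by (simp add: \<tau>_def c1.r_eq P2 inner_sum_right)
  have \<delta>: "(\<Sum>e\<in>E. t l e * (r2 e $ m)) = (if m = l then 1 else 0)" for m l
    using c2.q_frame[of m l] by (simp add: c2.r_eq t_def mult.commute)
  have G: "P2 j \<bullet> P2 l = (\<Sum>i\<in>UNIV. \<Sum>k\<in>UNIV. \<tau> $ i $ j * (P1 i \<bullet> P1 k) * \<tau> $ k $ l)"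
    unfolding P21 inner_sum_left inner_sum_right by (subst sum.swap) (simp add: mult_ac)
  have "h2 j l = (\<Sum>m\<in>UNIV. h2 j m * (\<Sum>e\<in>E. t l e * (r2 e $ m)))"
    by (simp add: \<delta> if_distrib cong: if_cong)
  also have "\<dots> = (\<Sum>e\<in>E. t l e * (\<Sum>m\<in>UNIV. h2 j m * (r2 e $ m)))"
    unfolding sum_distrib_left by (subst sum.swap) (simp add: mult_ac)
  also have "\<dots> = - (\<Sum>e\<in>E. t l e * (b e \<bullet> P2 j))"
    by (simp add: c2.weingarten sum_negf)
  also have "\<dots> = - (\<Sum>e\<in>E. t l e * (\<Sum>i\<in>UNIV. \<tau> $ i $ j * (b e \<bullet> P1 i)))"
    by (simp add: P21[of j] inner_sum_right)
  also have "\<dots> = (\<Sum>e\<in>E. \<Sum>i\<in>UNIV. \<Sum>k\<in>UNIV. \<tau> $ i $ j * h1 i k * (t l e * (r1 e $ k)))"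
    by (simp add: c1.weingarten sum_negf sum_distrib_left mult_ac)
  also have "\<dots> = (\<Sum>i\<in>UNIV. \<Sum>k\<in>UNIV. \<Sum>e\<in>E. \<tau> $ i $ j * h1 i k * (t l e * (r1 e $ k)))"
    by (simp add: sum.swap[of _ E])
  also have "\<dots> = (\<Sum>i\<in>UNIV. \<Sum>k\<in>UNIV. \<tau> $ i $ j * h1 i k * \<tau> $ k $ l)"
    unfolding \<tau>[of _ l] by (simp add: sum_distrib_left)
  finally have H: "h2 j l = (\<Sum>i\<in>UNIV. \<Sum>k\<in>UNIV. \<tau> $ i $ j * h1 i k * \<tau> $ k $ l)" .
  show ?thesis
    by (simp add: c1.Z_def c2.Z_def G H complex_eq_iff)
qed

section \<open>Mean curvature of a Legendrian immersion\<close>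

lemma has_derivative_eq_on_open:
  assumes "(f has_derivative f') (at u)" "(g has_derivative g') (at u)"
    and "open U" "u \<in> U" "\<And>y. y \<in> U \<Longrightarrow> f y = g y"
  shows "f' w = g' w"
proof -
  have "(g has_derivative f') (at u)"
    by (rule has_derivative_transform_within_open[OF assms(1,3,4)]) (rule assms(5))
  then show ?thesis using has_derivative_unique[OF assms(2)] by simp
qed

lemma smooth_onD:
  assumes "smooth_on S f"
  shows "x \<in> S \<Longrightarrow> (f has_derivative frechet_derivative f (at x)) (at x)"
    and "smooth_on S (\<lambda>x. frechet_derivative f (at x) w)"
  using assms Ck_on_SucD unfolding smooth_on_def by blast+

text \<open>Needed so that the \<open>SOME\<close> in \<open>metric_trace\<close> picks a genuine
  basis; it is the preimage of an orthonormal basis of the range of \<open>L\<close>.\<close>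

lemma exists_orthonormal_basis:
  fixes L :: "real ^ 'd \<Rightarrow> 'w::euclidean_space"
  assumes "linear L" "inj L"
  shows "\<exists>E. orthonormal_basis (\<lambda>w w'. L w \<bullet> L w') E"
proof -
  have sub: "subspace (range L)" using assms(1) by (simp add: linear_subspace_image)
  obtain B where B: "B \<subseteq> range L" "pairwise orthogonal B" "\<And>u. u \<in> B \<Longrightarrow> norm u = 1"
      "independent B" "card B = dim (range L)" "span B = range L"
    using orthonormal_basis_subspace[OF sub] by metis
  define E where "E = L -` B"
  have LE: "L ` E = B" using B(1) by (auto simp: E_def)
  have "finite E"
    unfolding E_def using B(4) assms(2) by (intro finite_vimageI) (auto intro: independent_imp_finite)
  moreover have "span E = UNIV"
  proof -
    have "L ` span E = L ` UNIV" using B(6) LE linear_span_image[OF assms(1), of E] by simp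
    then show ?thesis using assms(2) by (simp add: inj_image_eq_iff)
  qed
  moreover have "L e \<bullet> L e' = (if e = e' then 1 else 0)" if "e \<in> E" "e' \<in> E" for e e'
  proof (cases "e = e'")
    case True
    then show ?thesis using B(3)[of "L e"] that by (simp add: E_def norm_eq_1)
  next
    case False
    then have "L e \<noteq> L e'" using assms(2) by (simp add: inj_eq)
    then show ?thesis using B(2) that False by (simp add: E_def pairwise_def orthogonal_def)
  qed
  ultimately show ?thesis unfolding orthonormal_basis_def by blast
qed

section \<open>The symplectic form of \<open>Q\<close> in terms of the bracket\<close>

lemma subspace_TQ: "subspace (TQ q)"
proof -
  have "linear (\<lambda>\<eta>. bracket \<eta> q)"
    by (auto intro!: linearI simp: matrix_eq matrix_vector_bracket matrix_vector_mult_add_rdistrib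
        matrix_vector_right_distrib scaleR_matrix_vector_assoc[symmetric] matrix_vector_mult_scaleR
        matrix_vector_mult_diff_rdistrib scaleR_diff_right)
  then show ?thesis unfolding TQ_def by (rule linear_subspace_image[OF _ subspace_so])
qed

text \<open>\<open>bracket (piQ p)\<close> squares to -1 on the tangent space and is the complex
  structure there. The formula replaces a definite description by something visibly
  bilinear.\<close>

lemma lambdaQ_eq:
  assumes "p \<in> US" "X \<in> TQ (piQ p)" "Y \<in> TQ (piQ p)"
  shows "lambdaQ (piQ p) X Y = ip_so (bracket (piQ p) X) Y"
proof -
  obtain Z W where "Z \<in> TUS p" "X = dpiQ p Z" "W \<in> TUS p" "Y = dpiQ p W"
    using assms(2,3) unfolding dpiQ_TUS[OF assms(1), symmetric] by blast
  then show ?thesis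
    by (simp add: lambdaQ_pullback[OF assms(1)] minus_dtheta_eq[OF assms(1)])
qed

text \<open>The complex structure is skew and preserves \<open>TQ\<close>, so it can be moved onto
  \<open>X\<close>, against which the projection has no effect. Covariant derivatives can thus be
  evaluated by ordinary derivatives of matrices.\<close>

lemma lambdaQ_tan_proj:
  assumes "p \<in> US" "Y \<in> so" "X \<in> TQ (piQ p)"
  shows "lambdaQ (piQ p) (tan_proj (piQ p) Y) X = - ip_so Y (bracket (piQ p) X)"
proof -
  let ?q = "piQ p"
  have q: "?q \<in> Q" using assms(1) by (simp add: Q_def)
  have Xso: "X \<in> so" using assms(3) TQ_in_so[OF q] by blast
  have "bracket ?q X = bracket (- X) ?q" by (simp add: bracket_uminus bracket_antisym[of ?q])
  then have J: "bracket ?q X \<in> TQ ?q"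
    unfolding TQ_def using Xso subspace_neg[OF subspace_so] by blast
  have "lambdaQ ?q (tan_proj ?q Y) X = ip_so (bracket ?q (tan_proj ?q Y)) X"
    using assms tan_proj_props(1)[OF q] by (intro lambdaQ_eq) auto
  also have "\<dots> = - ip_so (bracket (tan_proj ?q Y) ?q) X"
    by (subst bracket_antisym) (simp add: ip_so_eq_half_inner[OF Xso])
  also have "\<dots> = - ip_so (tan_proj ?q Y) (bracket ?q X)" by (simp add: ip_so_bracket)
  also have "\<dots> = - ip_so Y (bracket ?q X)" using tan_proj_props(2)[OF q assms(2) J] by simp
  finally show ?thesis .
qed

text \<open>A local lift of the Gauss map to \<open>US\<close>, detached from f. Horizontality
  (\<open>contact\<close>) and a domain of half the dimension of \<open>Q\<close> make its
  projection Lagrangian.\<close>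

locale legendrian =
  fixes U :: "(real ^ 'd::finite) set" and x v :: "real ^ 'd \<Rightarrow> real ^ 'n::finite"
  assumes U: "open U" and smooth_x: "smooth_on U x" and smooth_v: "smooth_on U v"
    and xx: "u \<in> U \<Longrightarrow> x u \<bullet> x u = 1" and vv: "u \<in> U \<Longrightarrow> v u \<bullet> v u = 1" and xv: "u \<in> U \<Longrightarrow> x u \<bullet> v u = 0"
    and contact: "u \<in> U \<Longrightarrow> frechet_derivative x (at u) w \<bullet> v u = 0"
    and immersion: "u \<in> U \<Longrightarrow> frechet_derivative x (at u) w = 0 \<Longrightarrow> frechet_derivative v (at u) w = 0 \<Longrightarrow> w = 0"
    and dim: "CARD('d) + 2 = CARD('n)"
begin

text \<open>In \<open>a2 u w w'\<close> and \<open>b2 u w w'\<close> the derivative is taken first along \<open>w'\<close>, then along \<open>w\<close>.\<close>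

definition a where "a u w = frechet_derivative x (at u) w"
definition b where "b u w = frechet_derivative v (at u) w"
definition a2 where "a2 u w w' = frechet_derivative (\<lambda>u. a u w') (at u) w"
definition b2 where "b2 u w w' = frechet_derivative (\<lambda>u. b u w') (at u) w"

text \<open>The very basis which \<open>metric_trace\<close> chooses.\<close>

definition frame where "frame u = (SOME E. orthonormal_basis (induced_metric (\<lambda>u. piQ (x u, v u)) u) E)"

lemma derivs:
  assumes "u \<in> U"
  shows "(x has_derivative a u) (at u)" "(v has_derivative b u) (at u)"
    "((\<lambda>u. a u w) has_derivative (\<lambda>k. a2 u k w)) (at u)"
    "((\<lambda>u. b u w) has_derivative (\<lambda>k. b2 u k w)) (at u)"
  using smooth_onD(1)[OF smooth_x assms] smooth_onD(1)[OF smooth_v assms]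
    smooth_onD(1)[OF smooth_onD(2)[OF smooth_x] assms] smooth_onD(1)[OF smooth_onD(2)[OF smooth_v] assms]
  unfolding a_def[abs_def] b_def[abs_def] a2_def[abs_def] b2_def[abs_def] by auto

lemma symm:
  assumes "u \<in> U"
  shows "a2 u w w' = a2 u w' w" "b2 u w w' = b2 u w' w"
  using second_derivative_symmetric[OF U assms derivs(1) derivs(3)[OF assms] derivs(3)[OF assms]]
    second_derivative_symmetric[OF U assms derivs(2) derivs(4)[OF assms] derivs(4)[OF assms]]
  by auto

lemma lin:
  assumes "u \<in> U"
  shows "linear (a u)" "linear (b u)"
  using derivs(1,2)[OF assms] has_derivative_linear by auto

lemma perp:
  assumes "u \<in> U"
  shows "a u w \<bullet> x u = 0" "a u w \<bullet> v u = 0" "b u w \<bullet> x u = 0" "b u w \<bullet> v u = 0"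
proof -
  note d = derivs(1,2)[OF assms]
  show 1: "a u w \<bullet> v u = 0" using contact[OF assms] by (simp add: a_def)
  have "x u \<bullet> a u w + a u w \<bullet> x u = 0"
    by (rule has_derivative_eq_on_open[OF has_derivative_inner[OF d(1) d(1)] has_derivative_const U assms]) (rule xx)
  then show "a u w \<bullet> x u = 0" by (simp add: inner_commute)
  have "v u \<bullet> b u w + b u w \<bullet> v u = 0"
    by (rule has_derivative_eq_on_open[OF has_derivative_inner[OF d(2) d(2)] has_derivative_const U assms]) (rule vv)
  then show "b u w \<bullet> v u = 0" by (simp add: inner_commute)
  have "x u \<bullet> b u w + a u w \<bullet> v u = 0"
    by (rule has_derivative_eq_on_open[OF has_derivative_inner[OF d(1) d(2)] has_derivative_const U assms]) (rule xv)
  then show "b u w \<bullet> x u = 0" using 1 by (simp add: inner_commute)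
qed

text \<open>Differentiating \<open>contact\<close> expresses a u w \<bullet> b u k through second
  derivatives of \<open>x\<close>, which are symmetric in \<open>w\<close> and \<open>k\<close>.
  This is the vanishing of d\<theta> on the lift.\<close>

lemma lagrangian:
  assumes "u \<in> U"
  shows "a u w \<bullet> b u w' = b u w \<bullet> a u w'"
proof -
  have *: "a u w \<bullet> b u k + a2 u k w \<bullet> v u = 0" for w k
    by (rule has_derivative_eq_on_open[OF has_derivative_inner[OF derivs(3)[OF assms] derivs(2)[OF assms]]
          has_derivative_const U assms]) (rule perp)
  show ?thesis using *[of w w'] *[of w' w] symm[OF assms, of w w'] by (simp add: inner_commute)
qed

text \<open>Together with \<open>symm\<close> this is the total symmetry of \<open>\<lambda>\<^sub>Q(\<nabla>\<^sub>k dF(w), dF(w'))\<close>.\<close>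

lemma cubic_form_symmetric:
  assumes "u \<in> U"
  shows "a2 u k w \<bullet> b u w' - b2 u k w \<bullet> a u w' = a2 u k w' \<bullet> b u w - b2 u k w' \<bullet> a u w"
proof -
  note d = derivs(3,4)[OF assms]
  have "a u w \<bullet> b2 u k w' + a2 u k w \<bullet> b u w' = b u w \<bullet> a2 u k w' + b2 u k w \<bullet> a u w'"
    by (rule has_derivative_eq_on_open[OF has_derivative_inner[OF d(1,2)] has_derivative_inner[OF d(2,1)] U assms])
      (rule lagrangian)
  then show ?thesis by (simp add: inner_commute algebra_simps)
qed

section \<open>Second fundamental form and mean curvature of the projection to
  \<open>Q\<close>\<close>

abbreviation F where "F \<equiv> \<lambda>u. piQ (x u, v u)"

lemma US: "u \<in> U \<Longrightarrow> (x u, v u) \<in> US"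
  using xx vv xv by (simp add: US_def norm_eq_1)

lemma TUS:
  assumes "u \<in> U"
  shows "(a u w, b u w) \<in> TUS (x u, v u)"
  using perp[OF assms] by (simp add: TUS_def inner_commute)

lemma deriv_F:
  assumes "u \<in> U"
  shows "(F has_derivative frechet_derivative F (at u)) (at u)"
    and "frechet_derivative F (at u) w = piQ (a u w, v u) + piQ (x u, b u w)"
    and "frechet_derivative F (at u) w = dpiQ (x u, v u) (a u w, b u w)"
proof -
  have *: "(F has_derivative (\<lambda>h. piQ (x u, b u h) + piQ (a u h, v u))) (at u)"
    by (rule bounded_bilinear.FDERIV[OF bounded_bilinear_piQ derivs(1,2)[OF assms]])
  note D = frechet_derivative_at[OF *, symmetric]
  show 1: "frechet_derivative F (at u) w = piQ (a u w, v u) + piQ (x u, b u w)"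
    unfolding D by (rule add.commute)
  show "(F has_derivative frechet_derivative F (at u)) (at u)"
    unfolding D by (rule *)
  show "frechet_derivative F (at u) w = dpiQ (x u, v u) (a u w, b u w)"
    by (simp add: 1 dpiQ_eq)
qed

lemma deriv_F_TQ: "u \<in> U \<Longrightarrow> frechet_derivative F (at u) w \<in> TQ (F u)"
  unfolding deriv_F(3) dpiQ_TUS[OF US, symmetric] using TUS by blast

lemma induced_metric_eq:
  assumes "u \<in> U"
  shows "induced_metric F u = (\<lambda>w w'. (a u w, b u w) \<bullet> (a u w', b u w'))"
proof (intro ext)
  fix w w'
  have "contact_form (x u, v u) (a u w, b u w) = 0" for w
    using perp[OF assms] by (simp add: contact_form_def)
  then show "induced_metric F u w w' = (a u w, b u w) \<bullet> (a u w', b u w')"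
    unfolding induced_metric_def deriv_F(3)[OF assms]
    by (subst hQ_dpiQ_horizontal[OF US[OF assms] TUS[OF assms] TUS[OF assms]]) auto
qed

lemma orthonormal_basis_frame:
  assumes "u \<in> U"
  shows "orthonormal_basis (\<lambda>w w'. (a u w, b u w) \<bullet> (a u w', b u w')) (frame u)"
proof -
  have "linear (\<lambda>w. (a u w, b u w))"
    using lin[OF assms] by (auto intro!: linearI simp: linear_add linear_cmul)
  moreover from this have "inj (\<lambda>w. (a u w, b u w))"
    using immersion[OF assms] by (simp add: linear_injective_0 a_def b_def zero_prod_def)
  ultimately show ?thesis
    unfolding frame_def induced_metric_eq[OF assms] using someI_ex[OF exists_orthonormal_basis] by blast
qed

lemma frame:
  assumes "u \<in> U"
  shows "lagrangian_frame (frame u) (a u) (b u) (x u) (v u)"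
proof
  note o = orthonormal_basis_frame[OF assms, unfolded orthonormal_basis_def]
  show "finite (frame u)" using o by blast
  have "dim (UNIV :: (real ^ 'd) set) \<le> card (frame u)"
    using o by (metis dim_le_card' dim_span)
  then show "DIM(real ^ 'n) \<le> card (frame u) + 2" using dim by simp
  show "a u e \<bullet> a u e' + b u e \<bullet> b u e' = (if e = e' then 1 else 0)"
    if "e \<in> frame u" "e' \<in> frame u" for e e' using o that by simp
qed (use assms xx vv xv perp lagrangian in auto)

lemma lambdaQ_cov_deriv:
  assumes "u \<in> U"
  shows "cov_deriv F (\<lambda>u. frechet_derivative F (at u) w') u k \<in> TQ (F u)" (is ?A)
    and "lambdaQ (F u) (cov_deriv F (\<lambda>u. frechet_derivative F (at u) w') u k) (frechet_derivative F (at u) w)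
      = a2 u k w' \<bullet> b u w - b2 u k w' \<bullet> a u w" (is ?B)
proof -
  note d = derivs[OF assms]
  let ?Y = "piQ (a2 u k w', v u) + piQ (a u w', b u k) + piQ (a u k, b u w') + piQ (x u, b2 u k w')"
  have "((\<lambda>u. piQ (a u w', v u) + piQ (x u, b u w')) has_derivative
      (\<lambda>k. (piQ (a u w', b u k) + piQ (a2 u k w', v u)) + (piQ (x u, b2 u k w') + piQ (a u k, b u w')))) (at u)"
    by (intro has_derivative_add bounded_bilinear.FDERIV[OF bounded_bilinear_piQ] d)
  then have "((\<lambda>u. frechet_derivative F (at u) w') has_derivative
      (\<lambda>k. (piQ (a u w', b u k) + piQ (a2 u k w', v u)) + (piQ (x u, b2 u k w') + piQ (a u k, b u w')))) (at u)"
    by (rule has_derivative_transform_within_open[OF _ U assms]) (simp add: deriv_F(2))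
  note D = frechet_derivative_at[OF this, symmetric]
  have Y: "frechet_derivative (\<lambda>u. frechet_derivative F (at u) w') (at u) k = ?Y"
    unfolding D by (simp only: add_ac)
  have Yso: "?Y \<in> so" by (intro subspace_add[OF subspace_so] piQ_in_so)
  have q: "F u \<in> Q" using US[OF assms] by (simp add: Q_def)
  show ?A unfolding cov_deriv_def Y by (rule tan_proj_props(1)[OF q Yso])
  have i: "x u \<bullet> x u = 1" "v u \<bullet> v u = 1" "x u \<bullet> v u = 0" "v u \<bullet> x u = 0"
    using xx[OF assms] vv[OF assms] xv[OF assms] by (auto simp: inner_commute)
  have t: "x u \<bullet> a u w = 0" "v u \<bullet> a u w = 0" "x u \<bullet> b u w = 0" "v u \<bullet> b u w = 0"
      "a u w \<bullet> x u = 0" "a u w \<bullet> v u = 0" "b u w \<bullet> x u = 0" "b u w \<bullet> v u = 0" for w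
    using perp[OF assms, of w] by (auto simp: inner_commute)
  have qm: "F u *v x u = v u" "F u *v v u = - x u" "F u *v a u w = 0" "F u *v b u w = 0"
    using i t by (simp_all add: piQ_mult)
  have "bracket (F u) (frechet_derivative F (at u) w) = piQ (v u, b u w) - piQ (a u w, x u)"
    unfolding deriv_F(2)[OF assms] bracket_add bracket_piQ[OF piQ_in_so] qm
    by (simp add: piQ_alg) (simp add: piQ_def vec_eq_iff)
  then have "lambdaQ (F u) (tan_proj (F u) ?Y) (frechet_derivative F (at u) w)
      = - ip_so ?Y (piQ (v u, b u w) - piQ (a u w, x u))"
    using lambdaQ_tan_proj[OF US[OF assms] Yso deriv_F_TQ[OF assms]] by simp
  also have "\<dots> = - (ip_so ?Y (piQ (v u, b u w)) - ip_so ?Y (piQ (a u w, x u)))"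
    by (simp add: ip_so_eq_half_inner piQ_in_so subspace_diff[OF subspace_so] inner_diff_right right_diff_distrib)
  also have "\<dots> = - ((?Y *v v u) \<bullet> b u w - (?Y *v a u w) \<bullet> x u)"
    by (simp only: ip_so_piQ[OF Yso])
  \<comment> \<open>The two mixed terms of \<open>?Y\<close> vanish because the values of
    \<open>a\<close> and \<open>b\<close> are orthogonal to \<open>x u\<close> and
    \<open>v u\<close>.\<close>
  also have "\<dots> = a2 u k w' \<bullet> b u w - b2 u k w' \<bullet> a u w"
    using i t by (simp add: matrix_vector_mult_add_rdistrib piQ_mult inner_diff_left inner_add_left)
  finally show ?B unfolding cov_deriv_def Y .
qed

lemma lambdaQ_tangent:
  assumes "u \<in> U"
  shows "lambdaQ (F u) (frechet_derivative F (at u) w) (frechet_derivative F (at u) w') = 0"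
  unfolding deriv_F(3)[OF assms]
  by (subst lambdaQ_pullback[OF US[OF assms] TUS[OF assms] TUS[OF assms]])
    (use lagrangian[OF assms] in \<open>simp add: ext_deriv_contact inner_commute\<close>)

text \<open>On \<open>TQ\<close> the metric \<open>hQ\<close> is half the Euclidean inner product of
  matrices, so the normal part is a Euclidean orthogonal component. The tangential remainder is
  invisible to \<open>lambdaQ\<close> by \<open>lambdaQ_tangent\<close>.\<close>

lemma second_ff:
  assumes "u \<in> U"
  shows "second_ff F u k w' \<in> TQ (F u)" (is ?A)
    and "lambdaQ (F u) (second_ff F u k w') (frechet_derivative F (at u) w)
      = a2 u k w' \<bullet> b u w - b2 u k w' \<bullet> a u w" (is ?B)
proof -
  let ?D = "frechet_derivative F (at u)"
  define C where "C = cov_deriv F (\<lambda>u. frechet_derivative F (at u) w') u k"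
  have q: "F u \<in> Q" using US[OF assms] by (simp add: Q_def)
  have linD: "linear ?D" using deriv_F(1)[OF assms] has_derivative_linear by blast
  have C: "C \<in> TQ (F u)" unfolding C_def by (rule lambdaQ_cov_deriv(1)[OF assms])
  have hQ: "hQ (F u) X (?D y) = (1/2) * (X \<bullet> ?D y)" if "X \<in> TQ (F u)" for X y
    using hQ_eq_ip_so[OF q that deriv_F_TQ[OF assms]] TQ_in_so[OF q deriv_F_TQ[OF assms]]
    by (simp add: ip_so_eq_half_inner)
  obtain y0 N0 where dec: "y0 \<in> span (range ?D)" "\<And>w. w \<in> span (range ?D) \<Longrightarrow> orthogonal N0 w" "C = y0 + N0"
    by (rule orthogonal_subspace_decomp_exists[of "range ?D" C]) (rule that)
  have spanD: "span (range ?D) = range ?D"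
    using linear_subspace_image[OF linD subspace_UNIV] by simp
  obtain y where y: "y0 = ?D y" using dec(1) unfolding spanD by blast
  have orth: "N0 \<bullet> ?D y = 0" for y using dec(2)[unfolded spanD] by (auto simp: orthogonal_def)
  have N0: "N0 \<in> TQ (F u)"
    using subspace_diff[OF subspace_TQ C deriv_F_TQ[OF assms, of y]] dec(3) y by simp
  let ?p = "\<lambda>N. N \<in> TQ (F u) \<and> (\<forall>y. hQ (F u) N (?D y) = 0) \<and> (\<exists>y. C = N + ?D y)"
  have "second_ff F u k w' = (THE N. ?p N)" by (simp add: second_ff_def C_def)
  also have "\<dots> = N0"
  proof (rule the_equality)
    show "?p N0" using N0 dec(3) y hQ[OF N0] orth by (auto simp: add.commute)
  next
    fix N assume N: "?p N"
    then obtain z where z: "C = N + ?D z" by blast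
    have eqD: "N - N0 = ?D (y - z)" using z dec(3) y by (simp add: linear_diff[OF linD] algebra_simps)
    have "(N - N0) \<bullet> ?D (y - z) = 0"
      using N hQ[of N "y - z"] orth[of "y - z"] by (simp add: inner_diff_left)
    then have "(N - N0) \<bullet> (N - N0) = 0" by (simp only: eqD)
    then show "N = N0" by simp
  qed
  finally have eq: "second_ff F u k w' = N0" .
  then show ?A using N0 by simp
  have "lambdaQ (F u) C (?D w) = lambdaQ (F u) (?D y) (?D w) + lambdaQ (F u) N0 (?D w)"
    unfolding lambdaQ_eq[OF US[OF assms] C deriv_F_TQ[OF assms]]
      lambdaQ_eq[OF US[OF assms] N0 deriv_F_TQ[OF assms]]
      lambdaQ_eq[OF US[OF assms] deriv_F_TQ[OF assms] deriv_F_TQ[OF assms]]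
    using TQ_in_so[OF q deriv_F_TQ[OF assms]]
    by (simp add: dec(3) y bracket_add ip_so_eq_half_inner inner_add_left distrib_left)
  then show ?B
    using lambdaQ_cov_deriv(2)[OF assms] lambdaQ_tangent[OF assms] by (simp add: eq C_def)
qed

text \<open>Total symmetry of the cubic form makes \<open>w\<close> the direction of
  differentiation. Each summand becomes minus the imaginary part of the Hermitian product of the
  derivative of a e + i b e, for constant e, with a e + i b e: minus a logarithmic derivative of the
  frame determinant.\<close>

lemma lambdaQ_mean_curvature:
  assumes "u \<in> U"
  shows "lambdaQ (F u) (mean_curvature F u) (frechet_derivative F (at u) w)
      = (\<Sum>e\<in>frame u. a2 u w e \<bullet> b u e - b2 u w e \<bullet> a u e)"
proof -
  let ?D = "frechet_derivative F (at u)" and ?S = "\<lambda>e. second_ff F u e e"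
  have q: "F u \<in> Q" using US[OF assms] by (simp add: Q_def)
  have Dso: "?D w \<in> so" using TQ_in_so[OF q deriv_F_TQ[OF assms]] .
  have sum: "ip_so (bracket (F u) (\<Sum>e\<in>I. ?S e)) (?D w) = (\<Sum>e\<in>I. ip_so (bracket (F u) (?S e)) (?D w))"
    if "finite I" for I
    using that by (induction I) (simp_all add: bracket_add ip_so_eq_half_inner[OF Dso] inner_add_left)
  have H: "mean_curvature F u = (\<Sum>e\<in>frame u. ?S e)"
    by (simp add: mean_curvature_def metric_trace_def frame_def)
  have "mean_curvature F u \<in> TQ (F u)"
    unfolding H by (intro subspace_sum[OF subspace_TQ] second_ff(1) assms)
  then have "lambdaQ (F u) (mean_curvature F u) (?D w) = (\<Sum>e\<in>frame u. ip_so (bracket (F u) (?S e)) (?D w))"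
    using lambdaQ_eq[OF US[OF assms] _ deriv_F_TQ[OF assms]] sum orthonormal_basis_frame[OF assms]
    by (simp add: H orthonormal_basis_def)
  also have "\<dots> = (\<Sum>e\<in>frame u. lambdaQ (F u) (?S e) (?D w))"
    using lambdaQ_eq[OF US[OF assms] second_ff(1)[OF assms] deriv_F_TQ[OF assms]] by simp
  also have "\<dots> = (\<Sum>e\<in>frame u. a2 u w e \<bullet> b u e - b2 u w e \<bullet> a u e)"
    unfolding second_ff(2)[OF assms] using cubic_form_symmetric[OF assms] symm[OF assms] by (metis (no_types, lifting))
  finally show ?thesis .
qed

end

section \<open>The Lagrangian angle of the Gauss map\<close>

lemma linear_axis_expansion:
  fixes L :: "real ^ 'm \<Rightarrow> 'w::real_vector"
  assumes "linear L"
  shows "L w = (\<Sum>i\<in>UNIV. (w $ i) *\<^sub>R L (axis i 1))"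
proof -
  interpret linear L by fact
  have "L w = L (\<Sum>i\<in>UNIV. (w $ i) *\<^sub>R axis i 1)"
    using basis_expansion[of w] by (simp add: scalar_mult_eq_scaleR)
  then show ?thesis by (simp only: sum scale)
qed

text \<open>The Gram map \<open>g\<close> of an independent family is injective, hence surjective;
  solving for the unit vectors gives \<open>q\<close>.\<close>

lemma exists_dual_basis:
  fixes P :: "'m::finite \<Rightarrow> 'v::real_inner"
  assumes inj: "\<And>w :: real ^ 'm. (\<Sum>i\<in>UNIV. (w $ i) *\<^sub>R P i) = 0 \<Longrightarrow> w = 0"
  shows "\<exists>q. (\<forall>i. q i \<in> span (range P)) \<and> (\<forall>i j. q i \<bullet> P j = (if i = j then 1 else 0))"
proof -
  define L where "L w = (\<Sum>i\<in>UNIV. (w $ i) *\<^sub>R P i)" for w :: "real ^ 'm"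
  define g :: "real ^ 'm \<Rightarrow> real ^ 'm" where "g w = (\<chi> j. L w \<bullet> P j)" for w
  have lin: "linear g"
    by (rule linearI)
      (simp_all add: g_def L_def vec_eq_iff scaleR_add_left sum.distrib inner_add_left
        inner_sum_left sum_distrib_left mult.assoc)
  have "w = 0" if "g w = 0" for w
  proof -
    have "L w \<bullet> P j = 0" for j using that by (simp add: g_def vec_eq_iff)
    then have "L w \<bullet> L w = 0" by (subst (2) L_def) (simp add: inner_sum_right)
    then show "w = 0" using inj[of w] by (simp add: L_def)
  qed
  then have "surj g"
    using lin by (intro linear_injective_imp_surjective) (auto simp: linear_injective_0)
  then have "\<exists>w. g w = axis i 1" for i by (metis surjD)
  then obtain w where w: "g (w i) = axis i 1" for i by metis
  have "L (w i) \<bullet> P j = (if i = j then 1 else 0)" for i j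
    using arg_cong[OF w[of i], of "\<lambda>z. z $ j"] by (simp add: g_def axis_def)
  moreover have "L (w i) \<in> span (range P)" for i
    unfolding L_def by (intro span_sum span_scale span_base) simp
  ultimately show ?thesis by (intro exI[of _ "\<lambda>i. L (w i)"]) blast
qed

lemma has_derivative_Complex:
  assumes "(f has_derivative f') F" "(g has_derivative g') F"
  shows "((\<lambda>x. Complex (f x) (g x)) has_derivative (\<lambda>h. Complex (f' h) (g' h))) F"
  unfolding Complex_eq
  by (intro has_derivative_add has_derivative_mult_right has_derivative_of_real assms)

lemma Ck_on_Complex:
  assumes "open S" "Ck_on k S f" "Ck_on k S g"
  shows "Ck_on k S (\<lambda>x. Complex (f x) (g x))"
  unfolding Complex_eq
  by (intro Ck_on_add Ck_on_bilinear[OF bounded_bilinear_mult assms(1) Ck_on_const]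
      Ck_on_linear[OF bounded_linear_of_real] assms)

text \<open>The matrix G + i h. It refers to a chart of M and a normal vector but to no
  parametrisation of the normal bundle, so it can define a function on the whole bundle.\<close>

definition shape_matrix :: "(real ^ 'm \<Rightarrow> 'v::real_inner) \<Rightarrow> real ^ 'm \<Rightarrow> 'v \<Rightarrow> complex ^ 'm ^ 'm" where
  "shape_matrix \<phi> y \<nu> = (\<chi> i j. Complex
     (frechet_derivative \<phi> (at y) (axis i 1) \<bullet> frechet_derivative \<phi> (at y) (axis j 1))
     (\<nu> \<bullet> frechet_derivative (\<lambda>y. frechet_derivative \<phi> (at y) (axis i 1)) (at y) (axis j 1)))"

text \<open>A parametrised piece of the unit normal bundle over one chart of M:
  \<open>\<phi>\<close> is the immersion in that chart and \<open>r\<close> gives the coordinates of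
  the base point.\<close>

locale normal_chart = legendrian U x v
  for U :: "(real ^ 'd::finite) set" and x v :: "real ^ 'd \<Rightarrow> real ^ 'n::finite" +
  fixes Y :: "(real ^ 'm::finite) set" and \<phi> :: "real ^ 'm \<Rightarrow> real ^ 'n" and r :: "real ^ 'd \<Rightarrow> real ^ 'm"
  assumes Y: "open Y" and smooth_\<phi>: "smooth_on Y \<phi>" and smooth_r: "smooth_on U r"
    and r_Y: "u \<in> U \<Longrightarrow> r u \<in> Y" and x_eq: "u \<in> U \<Longrightarrow> x u = \<phi> (r u)"
    and \<phi>_sphere: "y \<in> Y \<Longrightarrow> \<phi> y \<bullet> \<phi> y = 1"
    and normal: "u \<in> U \<Longrightarrow> v u \<bullet> frechet_derivative \<phi> (at (r u)) z = 0"
    and \<phi>_inj: "u \<in> U \<Longrightarrow> frechet_derivative \<phi> (at (r u)) z = 0 \<Longrightarrow> z = 0"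
begin

section \<open>The fundamental forms in a chart and the derivative of the angle\<close>

definition \<phi>1 where "\<phi>1 i y = frechet_derivative \<phi> (at y) (axis i 1)"
definition \<phi>2 where "\<phi>2 i j y = frechet_derivative (\<phi>1 i) (at y) (axis j 1)"
definition R where "R u w = frechet_derivative r (at u) w"
definition P where "P u i = \<phi>1 i (r u)"
definition h where "h u i j = v u \<bullet> \<phi>2 i j (r u)"

lemma smooth_\<phi>1: "smooth_on Y (\<phi>1 i)"
  unfolding \<phi>1_def by (rule smooth_onD(2)[OF smooth_\<phi>])

lemma smooth_P: "smooth_on U (\<lambda>u. P u i)"
  using smooth_\<phi>1 smooth_r r_Y unfolding smooth_on_def P_def
  by (blast intro: Ck_on_compose[OF U])

lemma smooth_h: "smooth_on U (\<lambda>u. h u i j)"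
proof -
  have "smooth_on Y (\<phi>2 i j)" unfolding \<phi>2_def by (rule smooth_onD(2)[OF smooth_\<phi>1])
  then have "Ck_on k U (\<lambda>u. \<phi>2 i j (r u))" for k
    using smooth_r r_Y unfolding smooth_on_def by (blast intro: Ck_on_compose[OF U])
  then show ?thesis
    using smooth_v unfolding smooth_on_def h_def
    by (intro allI Ck_on_bilinear[OF bounded_bilinear_inner U]) auto
qed

lemma shape_matrix_eq: "shape_matrix \<phi> (r u) (v u) = (\<chi> i j. Complex (P u i \<bullet> P u j) (h u i j))"
  unfolding shape_matrix_def P_def h_def \<phi>2_def \<phi>1_def ..

lemma deriv_r: "u \<in> U \<Longrightarrow> (r has_derivative R u) (at u)"
  using smooth_onD(1)[OF smooth_r] unfolding R_def[abs_def] .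

lemma P_derivative:
  assumes "u \<in> U"
  shows "frechet_derivative \<phi> (at (r u)) z = (\<Sum>i\<in>UNIV. (z $ i) *\<^sub>R P u i)"
  unfolding P_def \<phi>1_def
  by (rule linear_axis_expansion[OF has_derivative_linear[OF smooth_onD(1)[OF smooth_\<phi> r_Y[OF assms]]]])

lemma a_eq:
  assumes "u \<in> U"
  shows "a u w = (\<Sum>i\<in>UNIV. (R u w $ i) *\<^sub>R P u i)"
proof -
  have "a u w = frechet_derivative \<phi> (at (r u)) (R u w)"
    by (rule has_derivative_eq_on_open[OF derivs(1)[OF assms]
          has_derivative_compose[OF deriv_r[OF assms] smooth_onD(1)[OF smooth_\<phi> r_Y[OF assms]]] U assms])
      (rule x_eq)
  then show ?thesis by (simp add: P_derivative[OF assms])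
qed

lemma weingarten:
  assumes "u \<in> U"
  shows "b u w \<bullet> P u i = - (\<Sum>j\<in>UNIV. h u i j * (R u w $ j))"
proof -
  note d\<phi> = smooth_onD(1)[OF smooth_\<phi>1 r_Y[OF assms], of i]
  have "v u \<bullet> frechet_derivative (\<phi>1 i) (at (r u)) (R u w) + b u w \<bullet> P u i = 0"
    unfolding P_def
    by (rule has_derivative_eq_on_open[OF has_derivative_inner[OF derivs(2)[OF assms]
          has_derivative_compose[OF deriv_r[OF assms] d\<phi>]] has_derivative_const U assms])
      (use normal in \<open>simp add: \<phi>1_def\<close>)
  moreover have "frechet_derivative (\<phi>1 i) (at (r u)) (R u w) = (\<Sum>j\<in>UNIV. (R u w $ j) *\<^sub>R \<phi>2 i j (r u))"
    unfolding \<phi>2_def by (rule linear_axis_expansion[OF has_derivative_linear[OF d\<phi>]])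
  ultimately show ?thesis
    by (simp add: h_def inner_sum_right mult.commute)
qed

lemma exists_chart_frame:
  assumes "u \<in> U"
  shows "\<exists>q. chart_frame (frame u) (a u) (b u) (x u) (v u) (P u) (h u) (R u) q"
proof -
  have "\<exists>q. (\<forall>i. q i \<in> span (range (P u))) \<and> (\<forall>i j. q i \<bullet> P u j = (if i = j then 1 else 0))"
    by (rule exists_dual_basis) (use \<phi>_inj[OF assms] P_derivative[OF assms] in auto)
  then obtain q where q: "\<And>i. q i \<in> span (range (P u))" "\<And>i j. q i \<bullet> P u j = (if i = j then 1 else 0)"
    by blast
  interpret lagrangian_frame "frame u" "a u" "b u" "x u" "v u" by (rule frame[OF assms])
  have "chart_frame (frame u) (a u) (b u) (x u) (v u) (P u) (h u) (R u) q"
  proof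
    fix i j
    note d = smooth_onD(1)[OF smooth_\<phi> r_Y[OF assms]]
    have "\<phi> (r u) \<bullet> frechet_derivative \<phi> (at (r u)) (axis i 1)
        + frechet_derivative \<phi> (at (r u)) (axis i 1) \<bullet> \<phi> (r u) = 0"
      by (rule has_derivative_eq_on_open[OF has_derivative_inner[OF d d] has_derivative_const Y r_Y[OF assms]])
        (rule \<phi>_sphere)
    then show "P u i \<bullet> x u = 0" by (simp add: P_def \<phi>1_def x_eq[OF assms] inner_commute)
    show "P u i \<bullet> v u = 0" using normal[OF assms] by (simp add: P_def \<phi>1_def inner_commute)
    have "\<phi>2 i j (r u) = \<phi>2 j i (r u)"
      using second_derivative_symmetric[OF Y r_Y[OF assms] smooth_onD(1)[OF smooth_\<phi>]
          smooth_onD(1)[OF smooth_\<phi>1 r_Y[OF assms], unfolded \<phi>1_def]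
          smooth_onD(1)[OF smooth_\<phi>1 r_Y[OF assms], unfolded \<phi>1_def]]
      by (simp add: \<phi>2_def \<phi>1_def[abs_def])
    then show "h u i j = h u j i" by (simp add: h_def)
  qed (use q a_eq[OF assms] weingarten[OF assms] in auto)
  then show ?thesis by (intro exI[of _ q])
qed

abbreviation Zm where "Zm u \<equiv> shape_matrix \<phi> (r u) (v u)"

lemma shape_matrix_siegel:
  assumes "u \<in> U"
  shows "Zm u \<in> siegel_space"
proof -
  obtain q where q: "chart_frame (frame u) (a u) (b u) (x u) (v u) (P u) (h u) (R u) q"
    using exists_chart_frame[OF assms] by blast
  show ?thesis
    unfolding shape_matrix_eq chart_frame.Z_def[OF q, symmetric] by (rule chart_frame.Z_siegel[OF q])
qed

lemma smooth_det: "Ck_on k U (\<lambda>u. det (Zm u))"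
proof -
  have "Ck_on k U (\<lambda>u. Zm u $ i $ j)" for i j
    unfolding shape_matrix_eq vec_lambda_beta
    using smooth_P smooth_h unfolding smooth_on_def
    by (intro Ck_on_Complex[OF U] Ck_on_bilinear[OF bounded_bilinear_inner U]) blast+
  then show ?thesis
    unfolding det_def
    by (intro Ck_on_sum[OF U] Ck_on_bilinear[OF bounded_bilinear_mult U Ck_on_const] Ck_on_prod[OF U])
qed

lemma Im_log_derivative_det:
  assumes "u \<in> U"
  shows "Im (frechet_derivative (\<lambda>u. det (Zm u)) (at u) w / det (Zm u))
    = (\<Sum>e\<in>frame u. a2 u w e \<bullet> b u e - b2 u w e \<bullet> a u e)"
proof -
  obtain q where "chart_frame (frame u) (a u) (b u) (x u) (v u) (P u) (h u) (R u) q"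
    using exists_chart_frame[OF assms] by blast
  then interpret cf: chart_frame "frame u" "a u" "b u" "x u" "v u" "P u" "h u" "R u" q .
  have Z: "cf.Z = Zm u" by (simp add: cf.Z_def shape_matrix_eq)
  define P' where "P' w i = frechet_derivative (\<lambda>u. P u i) (at u) w" for w i
  define h' where "h' w i j = frechet_derivative (\<lambda>u. h u i j) (at u) w" for w i j
  define R' where "R' w e = frechet_derivative (\<lambda>u. R u e) (at u) w" for w e
  have dP: "((\<lambda>u. P u i) has_derivative (\<lambda>w. P' w i)) (at u)" for i
    unfolding P'_def by (rule smooth_onD(1)[OF smooth_P assms])
  have dh: "((\<lambda>u. h u i j) has_derivative (\<lambda>w. h' w i j)) (at u)" for i j
    unfolding h'_def by (rule smooth_onD(1)[OF smooth_h assms])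
  have dR: "((\<lambda>u. R u e) has_derivative (\<lambda>w. R' w e)) (at u)" for e
    unfolding R'_def R_def by (rule smooth_onD(1)[OF smooth_onD(2)[OF smooth_r] assms])
  have dR': "((\<lambda>u. R u e $ i) has_derivative (\<lambda>w. R' w e $ i)) (at u)" for e i
    by (rule bounded_linear.has_derivative[OF bounded_linear_vec_nth dR])
  define Z' where "Z' w = (\<chi> i j. Complex (P' w i \<bullet> P u j + P u i \<bullet> P' w j) (h' w i j))" for w
  have "((\<lambda>u. Zm u $ i $ j) has_derivative (\<lambda>w. Z' w $ i $ j)) (at u)" for i j
  proof -
    have "((\<lambda>u. P u i \<bullet> P u j) has_derivative (\<lambda>w. P' w i \<bullet> P u j + P u i \<bullet> P' w j)) (at u)"
      using has_derivative_inner[OF dP dP] by (simp add: add.commute)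
    from has_derivative_Complex[OF this dh] show ?thesis
      by (simp add: shape_matrix_eq Z'_def)
  qed
  from has_derivative_det[OF this cf.Zinv_mult[unfolded Z]]
  have "((\<lambda>u. det (Zm u)) has_derivative (\<lambda>w. det (Zm u) * trace (cf.Zinv ** Z' w))) (at u)" .
  from frechet_derivative_at[OF this, symmetric]
  have "frechet_derivative (\<lambda>u. det (Zm u)) (at u) w / det (Zm u) = trace (cf.Zinv ** Z' w)"
    using det_siegel_space[OF shape_matrix_siegel[OF assms]] by simp
  moreover have "Im (trace (cf.Zinv ** Z' w)) = (\<Sum>e\<in>frame u. a2 u w e \<bullet> b u e - b2 u w e \<bullet> a u e)"
  proof (rule cf.Im_trace_log_derivative)
    \<comment> \<open>\<open>a_eq\<close> and \<open>weingarten\<close> hold near \<open>u\<close>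
      for every constant direction, so they can be differentiated with \<open>e\<close> fixed,
      however \<open>frame\<close> may jump.\<close>
    fix e i
    have "a2 u w e = (\<Sum>i\<in>UNIV. (R u e $ i) *\<^sub>R P' w i + (R' w e $ i) *\<^sub>R P u i)"
      by (rule has_derivative_eq_on_open[OF derivs(3)[OF assms]
            has_derivative_sum[OF has_derivative_scaleR[OF dR' dP]] U assms]) (rule a_eq)
    then show "a2 u w e = (\<Sum>i\<in>UNIV. (R' w e $ i) *\<^sub>R P u i + (R u e $ i) *\<^sub>R P' w i)"
      by (simp add: add.commute)
    have "b u e \<bullet> P' w i + b2 u w e \<bullet> P u i
        = - (\<Sum>j\<in>UNIV. h u i j * (R' w e $ j) + h' w i j * (R u e $ j))"
      by (rule has_derivative_eq_on_open[OF has_derivative_inner[OF derivs(4)[OF assms] dP]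
            has_derivative_minus[OF has_derivative_sum[OF has_derivative_mult[OF dh dR']]] U assms])
        (rule weingarten)
    then show "b2 u w e \<bullet> P u i + b u e \<bullet> P' w i
        = - (\<Sum>j\<in>UNIV. h' w i j * (R u e $ j) + h u i j * (R' w e $ j))"
      by (simp add: add.commute)
  qed (simp add: Z'_def)
  ultimately show ?thesis by simp
qed

text \<open>\<open>l\<close> is only known to be continuous. Regularity comes from the smooth
  function c = det (G + i h), since a continuous logarithm of c has derivative dc / c.\<close>

lemma lagrangian_angle:
  assumes l: "continuous_on siegel_space l" "\<And>Z. Z \<in> siegel_space \<Longrightarrow> det Z = exp (l Z)"
  shows "Ck_on k U (\<lambda>u. Im (l (Zm u)))"
    and "u \<in> U \<Longrightarrow> ((\<lambda>u. Im (l (Zm u))) has_derivative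
      (\<lambda>w. lambdaQ (F u) (mean_curvature F u) (frechet_derivative F (at u) w))) (at u)"
proof -
  let ?c = "\<lambda>u. det (Zm u)"
  have dc: "(?c has_derivative frechet_derivative ?c (at u)) (at u)" if "u \<in> U" for u
    using smooth_det[of "Suc 0"] that by (rule Ck_on_SucD)
  have "continuous_on U Zm"
  proof -
    have "continuous_on U (\<lambda>u. P u i)" "continuous_on U (\<lambda>u. h u i j)" for i j
      using smooth_P smooth_h unfolding smooth_on_def by (metis Ck_on.simps(1))+
    then show ?thesis
      unfolding shape_matrix_eq Complex_eq by (intro continuous_intros)
  qed
  then have cont: "continuous_on U (\<lambda>u. l (Zm u))"
    using shape_matrix_siegel by (intro continuous_on_compose2[OF l(1)]) auto
  have d: "((\<lambda>u. Im (l (Zm u))) has_derivative (\<lambda>w. Im (frechet_derivative ?c (at u) w / ?c u))) (at u)"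
    if "u \<in> U" for u
    by (intro bounded_linear.has_derivative[OF bounded_linear_Im]
        has_derivative_continuous_logarithm[OF U that cont _ dc[OF that]] l(2) shape_matrix_siegel)
  show "((\<lambda>u. Im (l (Zm u))) has_derivative
      (\<lambda>w. lambdaQ (F u) (mean_curvature F u) (frechet_derivative F (at u) w))) (at u)" if "u \<in> U"
    using d[OF that] by (simp only: Im_log_derivative_det[OF that] lambdaQ_mean_curvature[OF that])
  have nz: "?c u \<noteq> 0" if "u \<in> U" for u
    using det_siegel_space[OF shape_matrix_siegel[OF that]] .
  show "Ck_on k U (\<lambda>u. Im (l (Zm u)))"
  proof (cases k)
    case 0
    then show ?thesis using cont by (simp add: continuous_on_Im)
  next
    case (Suc k')
    have "Ck_on k' U (\<lambda>u. Im (frechet_derivative ?c (at u) w * inverse (?c u)))" for w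
      by (intro Ck_on_linear[OF bounded_linear_Im U] Ck_on_bilinear[OF bounded_bilinear_mult U]
          Ck_on_inverse[OF U] Ck_on_SucD(2)[OF smooth_det] smooth_det nz)
    then have *: "Ck_on k' U (\<lambda>u. Im (frechet_derivative ?c (at u) w / ?c u))" for w
      by (simp only: divide_inverse)
    show ?thesis unfolding Suc by (rule Ck_on_SucI[OF U d *])
  qed
qed

end

section \<open>Gluing over the charts of M\<close>

lemma lagrangian_angle_chart_independent:
  assumes "normal_chart U x v Y \<phi> r" "normal_chart U' x v Y' \<phi>' r'" "u \<in> U" "u \<in> U'"
    and l: "continuous_on siegel_space l" "\<And>Z. Z \<in> siegel_space \<Longrightarrow> det Z = exp (l Z)"
  shows "Im (l (shape_matrix \<phi> (r u) (v u))) = Im (l (shape_matrix \<phi>' (r' u) (v u)))"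
proof -
  interpret c: normal_chart U x v Y \<phi> r by fact
  interpret c': normal_chart U' x v Y' \<phi>' r' by fact
  \<comment> \<open>\<open>frame\<close>, \<open>a\<close> and \<open>b\<close> depend on the lift
    alone, so both charts give a \<open>chart_frame\<close> over the same Lagrangian frame.\<close>
  obtain q q' where cf: "chart_frame (c.frame u) (c.a u) (c.b u) (x u) (v u) (c.P u) (c.h u) (c.R u) q"
    "chart_frame (c.frame u) (c.a u) (c.b u) (x u) (v u) (c'.P u) (c'.h u) (c'.R u) q'"
    using c.exists_chart_frame[OF assms(3)] c'.exists_chart_frame[OF assms(4)] by blast
  note Z = chart_frame.Z_def[OF cf(1), folded c.shape_matrix_eq] chart_frame.Z_def[OF cf(2), folded c'.shape_matrix_eq]
  have "Im (l (shape_matrix \<phi>' (r' u) (v u))) = Im (l (shape_matrix \<phi> (r u) (v u)))"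
    by (rule Im_log_det_congruence[OF l c.shape_matrix_siegel[OF assms(3)] c'.shape_matrix_siegel[OF assms(4)]
          chart_frame_change[OF cf, unfolded Z]])
  then show ?thesis by simp
qed

text \<open>\<open>unit_normal_params\<close> provides immersivity of base coordinates paired with
  the normal vector. As f is an immersion, dx = 0 forces dr = 0, which carries this over to the
  lift. Horizontality holds because dx is tangent to f and v is normal.\<close>

lemma normal_chart_unit_normal_params:
  fixes A :: "('m::finite, 'p::{t2_space, second_countable_topology}) param set"
    and f :: "'p \<Rightarrow> real ^ 'n::finite"
    and \<kappa> :: "real ^ 'd::finite \<Rightarrow> 'p \<times> (real ^ 'n)"
  assumes A: "oriented_atlas A" and f: "sphere_immersion A f" and dim: "CARD('d) + 2 = CARD('n)"
    and \<kappa>: "(D, \<kappa>) \<in> unit_normal_params A f" and c: "(D', \<kappa>') \<in> A"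
  shows "normal_chart {u \<in> D. fst (\<kappa> u) \<in> \<kappa>' ` D'} (\<lambda>u. f (fst (\<kappa> u))) (\<lambda>u. snd (\<kappa> u))
    D' (f \<circ> \<kappa>') (\<lambda>u. inv_into D' \<kappa>' (fst (\<kappa> u)))"
proof -
  let ?U = "{u \<in> D. fst (\<kappa> u) \<in> \<kappa>' ` D'}" and ?\<phi> = "f \<circ> \<kappa>'"
  let ?x = "\<lambda>u. f (fst (\<kappa> u))" and ?v = "\<lambda>u. snd (\<kappa> u)" and ?r = "\<lambda>u. inv_into D' \<kappa>' (fst (\<kappa> u))"
  let ?\<rho> = "\<lambda>u. (?r u, ?v u)"
  have D: "open D" "continuous_on D \<kappa>" "\<kappa> ` D \<subseteq> unit_normal_bundle A f"
    using \<kappa> openin_imp_subset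
    unfolding unit_normal_params_def local_param_def homeomorphism_def by blast+
  have \<rho>: "smooth_on ?U ?\<rho>" "\<And>u. u \<in> ?U \<Longrightarrow> inj (frechet_derivative ?\<rho> (at u))"
    using \<kappa> c by (auto simp: unit_normal_params_def Let_def)
  have D': "open D'" "open (\<kappa>' ` D')"
    using A c by (auto simp: oriented_atlas_def local_param_def)
  have \<phi>: "smooth_on D' ?\<phi>" "\<And>y. y \<in> D' \<Longrightarrow> inj (frechet_derivative ?\<phi> (at y))"
    using f c by (auto simp: sphere_immersion_def)
  have fp: "f p \<bullet> f p = 1" for p using f by (simp add: sphere_immersion_def norm_eq_1)
  have U: "open ?U"
  proof -
    have "open (D \<inter> (\<lambda>u. fst (\<kappa> u)) -` (\<kappa>' ` D'))"
      by (intro continuous_open_preimage continuous_on_fst D D')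
    moreover have "D \<inter> (\<lambda>u. fst (\<kappa> u)) -` (\<kappa>' ` D') = ?U" by auto
    ultimately show ?thesis by simp
  qed
  have r: "?r u \<in> D'" "\<kappa>' (?r u) = fst (\<kappa> u)" if "u \<in> ?U" for u
    using that by (auto intro: inv_into_into f_inv_into_f)
  have sr: "smooth_on ?U ?r" and sv: "smooth_on ?U ?v"
    using \<rho>(1) Ck_on_linear[OF bounded_linear_fst U, of _ ?\<rho>] Ck_on_linear[OF bounded_linear_snd U, of _ ?\<rho>]
    unfolding smooth_on_def by auto
  have sx: "smooth_on ?U ?x"
    unfolding smooth_on_def
  proof
    fix k
    have "Ck_on k ?U ?r" "Ck_on k D' ?\<phi>" using sr \<phi>(1) unfolding smooth_on_def by blast+
    moreover have "?r ` ?U \<subseteq> D'" using r(1) by blast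
    ultimately have "Ck_on k ?U (\<lambda>u. ?\<phi> (?r u))" by (rule Ck_on_compose[OF U])
    then show "Ck_on k ?U ?x" by (rule Ck_on_cong[OF U, rotated]) (simp add: r)
  qed
  have N: "norm (?v u) = 1" "?v u \<bullet> ?x u = 0" "\<And>t. t \<in> tangent_image A f (fst (\<kappa> u)) \<Longrightarrow> ?v u \<bullet> t = 0"
    if "u \<in> ?U" for u
  proof -
    have "\<kappa> u \<in> unit_normal_bundle A f" using D(3) that by auto
    then show "norm (?v u) = 1" "?v u \<bullet> ?x u = 0" "\<And>t. t \<in> tangent_image A f (fst (\<kappa> u)) \<Longrightarrow> ?v u \<bullet> t = 0"
      by (auto simp: unit_normal_bundle_def)
  qed
  have normal: "?v u \<bullet> frechet_derivative ?\<phi> (at (?r u)) z = 0" if "u \<in> ?U" for u z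
    using r[OF that] c by (intro N(3)[OF that]) (auto simp: tangent_image_def)
  have dx: "frechet_derivative ?x (at u) w = frechet_derivative ?\<phi> (at (?r u)) (frechet_derivative ?r (at u) w)"
    if u: "u \<in> ?U" for u w
    by (rule has_derivative_eq_on_open[OF smooth_onD(1)[OF sx u]
        has_derivative_compose[OF smooth_onD(1)[OF sr u] smooth_onD(1)[OF \<phi>(1) r(1)[OF u]]] U u])
      (simp add: r)
  have lin: "linear (frechet_derivative ?\<phi> (at (?r u)))" if "u \<in> ?U" for u
    using has_derivative_linear[OF smooth_onD(1)[OF \<phi>(1) r(1)[OF that]]] .
  have inj: "z = 0" if "u \<in> ?U" "frechet_derivative ?\<phi> (at (?r u)) z = 0" for u z
    using \<phi>(2)[OF r(1)[OF that(1)]] lin[OF that(1)] that(2) by (simp add: linear_injective_0)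
  show ?thesis
  proof
    show "frechet_derivative ?x (at u) w \<bullet> ?v u = 0" if "u \<in> ?U" for u w
      using normal[OF that] by (simp add: dx[OF that] inner_commute)
    show "w = 0" if u: "u \<in> ?U" and 0: "frechet_derivative ?x (at u) w = 0" "frechet_derivative ?v (at u) w = 0" for u w
    proof -
      have "frechet_derivative ?r (at u) w = 0" using inj[OF u] 0(1) by (simp add: dx[OF u])
      moreover have "frechet_derivative ?\<rho> (at u) w = (frechet_derivative ?r (at u) w, frechet_derivative ?v (at u) w)"
        using has_derivative_unique[OF smooth_onD(1)[OF \<rho>(1) u]
            has_derivative_Pair[OF smooth_onD(1)[OF sr u] smooth_onD(1)[OF sv u]]] by simp
      moreover have "linear (frechet_derivative ?\<rho> (at u))"
        using has_derivative_linear[OF smooth_onD(1)[OF \<rho>(1) u]] .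
      ultimately show "w = 0"
        using \<rho>(2)[OF u] 0(2) by (simp add: linear_injective_0 zero_prod_def)
    qed
    show "?x u = ?\<phi> (?r u)" if "u \<in> ?U" for u using r[OF that] by simp
  qed (use U sx sv sr fp N dim D' \<phi> r normal inj in \<open>auto simp: norm_eq_1 inner_commute\<close>)
qed

theorem proposition4p2:
  fixes A :: "('m::finite, 'p::{t2_space, second_countable_topology}) param set"
    and f :: "'p \<Rightarrow> real ^ 'n::finite"
  assumes "oriented_atlas A"
    and "sphere_immersion A f"
    and "CARD('d::finite) + 2 = CARD('n)"
  shows "hamiltonian_variation
           (unit_normal_params A f :: ('d, 'p \<times> (real ^ 'n)) param set)
           (geodesic_gauss f)
           (mean_curvature_field (geodesic_gauss f))"
proof -
  \<comment> \<open>One branch serves all charts, so that their angles agree exactly and not only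
    modulo multiples of \<pi>.\<close>
  obtain l :: "complex ^ 'm ^ 'm \<Rightarrow> complex"
    where l: "continuous_on siegel_space l" "\<And>Z. Z \<in> siegel_space \<Longrightarrow> det Z = exp (l Z)"
    using log_det_siegel_space by blast
  define angle where "angle c p \<nu> = Im (l (shape_matrix (f \<circ> snd c) (inv_into (fst c) (snd c) p) \<nu>))"
    for c :: "('m, 'p) param" and p \<nu>
  \<comment> \<open>The choice may jump from point to point; chart independence of the angle makes
    \<open>\<Theta>\<close> smooth nevertheless.\<close>
  define chart where "chart p = (SOME c. c \<in> A \<and> p \<in> snd c ` fst c)" for p
  define \<Theta> where "\<Theta> q = angle (chart (fst q)) (fst q) (snd q)" for q
  have chart_ex: "\<exists>c. c \<in> A \<and> p \<in> snd c ` fst c" for p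
  proof -
    have "p \<in> (\<Union>(D, \<kappa>)\<in>A. \<kappa> ` D)" using assms(1) by (simp add: oriented_atlas_def)
    then show ?thesis by force
  qed
  have chart: "chart p \<in> A" "p \<in> snd (chart p) ` fst (chart p)" for p
    using someI_ex[OF chart_ex[of p]] by (auto simp: chart_def)
  have main: "(\<forall>k. Ck_on k D (\<Theta> \<circ> \<kappa>)) \<and> (\<forall>u\<in>D. \<forall>w. frechet_derivative (\<Theta> \<circ> \<kappa>) (at u) w =
      variation_form (geodesic_gauss f) (mean_curvature_field (geodesic_gauss f)) \<kappa> u w)"
    if \<kappa>: "(D, \<kappa>) \<in> unit_normal_params A f" for D and \<kappa> :: "real ^ 'd \<Rightarrow> 'p \<times> (real ^ 'n)"
  proof -
    define U where "U c = {u \<in> D. fst (\<kappa> u) \<in> snd c ` fst c}" for c :: "('m, 'p) param"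
    let ?x = "\<lambda>u. f (fst (\<kappa> u))" and ?v = "\<lambda>u. snd (\<kappa> u)"
    let ?F = "\<lambda>u. piQ (?x u, ?v u)"
    have nc: "normal_chart (U c) ?x ?v (fst c) (f \<circ> snd c) (\<lambda>u. inv_into (fst c) (snd c) (fst (\<kappa> u)))"
      if "c \<in> A" for c
      unfolding U_def
      by (rule normal_chart_unit_normal_params[OF assms \<kappa>]) (simp add: that)
    have Fu: "geodesic_gauss f (\<kappa> u) = ?F u" for u
      by (simp add: geodesic_gauss_def spherical_gauss_def split_beta)
    then have F: "geodesic_gauss f \<circ> \<kappa> = ?F" by (simp add: fun_eq_iff)
    \<comment> \<open>Over a chart \<open>c\<close> the pointwise choice is traded for
      \<open>c\<close>, which stays fixed under differentiation.\<close>
    have \<Theta>: "(\<Theta> \<circ> \<kappa>) u = Im (l (shape_matrix (f \<circ> snd c) (inv_into (fst c) (snd c) (fst (\<kappa> u))) (?v u)))"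
      if "c \<in> A" "u \<in> U c" for c u
      unfolding \<Theta>_def angle_def comp_def[of _ \<kappa>]
      by (rule lagrangian_angle_chart_independent[OF nc[OF chart(1)] nc[OF that(1)] _ that(2) l])
        (use that(2) chart(2) in \<open>simp add: U_def\<close>)
    have loc: "open (U c)" "Ck_on k (U c) (\<Theta> \<circ> \<kappa>)"
      "u \<in> U c \<Longrightarrow> ((\<Theta> \<circ> \<kappa>) has_derivative
        (\<lambda>w. lambdaQ (?F u) (mean_curvature ?F u) (frechet_derivative ?F (at u) w))) (at u)"
      if c: "c \<in> A" for c k u
    proof -
      interpret normal_chart "U c" ?x ?v "fst c" "f \<circ> snd c" "\<lambda>u. inv_into (fst c) (snd c) (fst (\<kappa> u))"
        by (rule nc[OF c])
      show "open (U c)" by (rule U)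
      show "Ck_on k (U c) (\<Theta> \<circ> \<kappa>)"
        by (rule Ck_on_cong[OF U \<Theta>[OF c, symmetric] lagrangian_angle(1)[OF l]])
      show "((\<Theta> \<circ> \<kappa>) has_derivative
        (\<lambda>w. lambdaQ (?F u) (mean_curvature ?F u) (frechet_derivative ?F (at u) w))) (at u)" if "u \<in> U c"
        by (rule has_derivative_transform_within_open[OF lagrangian_angle(2)[OF l that] U that \<Theta>[OF c, symmetric]])
    qed
    have U_chart: "u \<in> U (chart (fst (\<kappa> u)))" if "u \<in> D" for u
      using that chart(2) by (simp add: U_def)
    have "Ck_on k D (\<Theta> \<circ> \<kappa>)" for k
      using loc(1,2)[OF chart(1)] U_chart by (intro Ck_on_local) blast
    moreover have "frechet_derivative (\<Theta> \<circ> \<kappa>) (at u) w =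
        variation_form (geodesic_gauss f) (mean_curvature_field (geodesic_gauss f)) \<kappa> u w" if "u \<in> D" for u w
      using frechet_derivative_at[OF loc(3)[OF chart(1) U_chart[OF that]], symmetric]
      by (simp add: variation_form_def mean_curvature_field_def F Fu)
    ultimately show ?thesis by blast
  qed
  show ?thesis
    unfolding hamiltonian_variation_def exact_one_form_def smooth_on_def
    using main by (intro exI[of _ \<Theta>]) blast
qed

end
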